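(* Let $H,G$ be Hilbert spaces, with $H$ separable and infinite-dimensional, let $\mathcal{A}:H\to G$ be a boundedly invertible linear operator, let $F\subset G$ be a Hilbert space continuously embedded in $G$, and let $S:F\to H$ be the restriction of $\mathcal{A}^{-1}$ to $F$. Assume that $$b_{2n}(S,F,H)\asymp b_n(S,F,H).$$ Then, for every $C\ge1$, $$e_n^{\mathrm{lin}}(S,F,H)=e_n^{\mathrm{cont}}(S,F,H)\asymp e_{n,C}^{\mathrm{non}}(S,F,H).$$
   Context: Spaces are real. For sequences, $a_n\asymp b_n$ means that each can be bounded by a constant multiple of the other, uniformly in $n\in\mathbb{N}$ (constants may depend on $S,F,H,C$); the equality is for every $n\in\mathbb{N}$. For a mapping $S_n:F\to H$ the worst case error is $e(S_n,F,H)=\sup_{\|f\|_F\le1}\|S(f)-S_n(f)\|_H$. Linear widths: $e_n^{\mathrm{lin}}(S,F,H)=\inf e(S_n,F,H)$ over all continuous linear mappings $S_n:F\to H$ of the form $S_n(f)=\sum_{i=1}^nL_i(f)\,\tilde h_i$ with arbitrary $\tilde h_i\in H$ ($L_i$ continuous linear functionals on $F$). Manifold widths: $e_n^{\mathrm{cont}}(S,F,H)=\inf e(\varphi_n\circ N_n,F,H)$ over all continuous mappings $N_n:F\to\mathbb{R}^n$ and $\varphi_n:\mathbb{R}^n\to H$. Nonlinear widths: a sequence $\mathcal{B}=\{h_i\mid i\in\mathbb{N}\}\subset H$ is a Riesz basis of $H$ if there are constants $A,B>0$ such that $A(\sum_k|\alpha_k|^2)^{1/2}\le\|\sum_k\alpha_kh_k\|_H\le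 B(\sum_k|\alpha_k|^2)^{1/2}$ for all finitely supported scalar sequences $(\alpha_k)$, and the finite sums $\sum\alpha_kh_k$ are dense in $H$; $A,B$ denote the optimal constants. For $C\ge1$, $\mathcal{B}_C$ is the set of Riesz bases of $H$ with $B/A\le C$. $\mathcal{N}_n(\mathcal{B})$ is the class of all (linear or nonlinear) mappings $S_n:F\to H$ of the form $S_n(f)=\sum_{k=1}^nc_kh_{i_k}$ with $c_k,i_k$ depending arbitrarily on $f$. Then $e_{n,C}^{\mathrm{non}}(S,F,H)=\inf_{\mathcal{B}\in\mathcal{B}_C}\inf_{S_n\in\mathcal{N}_n(\mathcal{B})}e(S_n,F,H)$. The $n$-th Bernstein width $b_n(S,F,H)$ is the radius of the largest $(n+1)$-dimensional ball (centered at the origin) of $H$ contained in $S(\{f\in F:\|f\|_F\le1\})$; equivalently (as $S$ is injective) $b_n(S,F,H)=\sup_X\inf_{0\ne x\in X}\|Sx\|_H/\|x\|_F$, the supremum over all $(n+1)$-dimensional subspaces $X\subset F$. *)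

theory Defs
  imports "HOL-Analysis.Analysis"
begin

(* Real Hilbert spaces are types of sort {real_inner, complete_space}.  All widths take values in
   ennreal: the worst case error of an arbitrary mapping may be infinite, and the infimum over an
   empty class is then infinite. *)

definition boundedly_invertible ::
    "('a::real_normed_vector \<Rightarrow> 'b::real_normed_vector) \<Rightarrow> bool" where
  "boundedly_invertible A \<longleftrightarrow> bounded_linear A \<and> bij A \<and> bounded_linear (inv A)"

(* The real constants c, d are uniform in n; no n is exempted, unlike in a bigtheta statement. *)
definition weakly_equivalent :: "(nat \<Rightarrow> ennreal) \<Rightarrow> (nat \<Rightarrow> ennreal) \<Rightarrow> bool"
    (infix "\<asymp>" 50) where
  "a \<asymp> b \<longleftrightarrow>
     (\<exists>c d :: real. c > 0 \<and> d > 0 \<and> (\<forall>n. a n \<le> ennreal c * b n \<and> b n \<le> ennreal d * a n))"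

definition worst_case_error ::
    "('f::real_normed_vector \<Rightarrow> 'h::real_normed_vector) \<Rightarrow> ('f \<Rightarrow> 'h) \<Rightarrow> ennreal" where
  "worst_case_error S T = (SUP f\<in>{f. norm f \<le> 1}. ennreal (norm (S f - T f)))"

definition linear_maps :: "nat \<Rightarrow> ('f::real_normed_vector \<Rightarrow> 'h::real_normed_vector) set" where
  "linear_maps n =
     {(\<lambda>f. \<Sum>i<n. L i f *\<^sub>R h i) | (L :: nat \<Rightarrow> 'f \<Rightarrow> real) (h :: nat \<Rightarrow> 'h).
        \<forall>i<n. bounded_linear (L i)}"

definition e_lin ::
    "('f::real_normed_vector \<Rightarrow> 'h::real_normed_vector) \<Rightarrow> nat \<Rightarrow> ennreal" where
  "e_lin S n = (INF T\<in>linear_maps n. worst_case_error S T)"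

(* Euclidean_space n is R^n, realised as the sequences that vanish from index n on; only the
   restriction of \<phi> to it matters. *)
definition manifold_maps :: "nat \<Rightarrow> ('f::real_normed_vector \<Rightarrow> 'h::real_normed_vector) set" where
  "manifold_maps n =
     {\<phi> \<circ> N | (N :: 'f \<Rightarrow> nat \<Rightarrow> real) (\<phi> :: (nat \<Rightarrow> real) \<Rightarrow> 'h).
        continuous_map euclidean (Euclidean_space n) N \<and>
        continuous_map (Euclidean_space n) euclidean \<phi>}"

definition e_cont ::
    "('f::real_normed_vector \<Rightarrow> 'h::real_normed_vector) \<Rightarrow> nat \<Rightarrow> ennreal" where
  "e_cont S n = (INF T\<in>manifold_maps n. worst_case_error S T)"

definition riesz_lower :: "(nat \<Rightarrow> 'h::real_normed_vector) \<Rightarrow> real \<Rightarrow> bool" where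
  "riesz_lower h A \<longleftrightarrow> A > 0 \<and>
     (\<forall>\<alpha> :: nat \<Rightarrow> real. finite {k. \<alpha> k \<noteq> 0} \<longrightarrow>
        A * sqrt (\<Sum>k | \<alpha> k \<noteq> 0. \<bar>\<alpha> k\<bar>\<^sup>2) \<le> norm (\<Sum>k | \<alpha> k \<noteq> 0. \<alpha> k *\<^sub>R h k))"

definition riesz_upper :: "(nat \<Rightarrow> 'h::real_normed_vector) \<Rightarrow> real \<Rightarrow> bool" where
  "riesz_upper h B \<longleftrightarrow> B > 0 \<and>
     (\<forall>\<alpha> :: nat \<Rightarrow> real. finite {k. \<alpha> k \<noteq> 0} \<longrightarrow>
        norm (\<Sum>k | \<alpha> k \<noteq> 0. \<alpha> k *\<^sub>R h k) \<le> B * sqrt (\<Sum>k | \<alpha> k \<noteq> 0. \<bar>\<alpha> k\<bar>\<^sup>2))"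

definition riesz_basis :: "(nat \<Rightarrow> 'h::real_normed_vector) \<Rightarrow> bool" where
  "riesz_basis h \<longleftrightarrow>
     (\<exists>A. riesz_lower h A) \<and> (\<exists>B. riesz_upper h B) \<and> closure (span (range h)) = UNIV"

definition riesz_A :: "(nat \<Rightarrow> 'h::real_normed_vector) \<Rightarrow> real" where
  "riesz_A h = Sup {A. riesz_lower h A}"

definition riesz_B :: "(nat \<Rightarrow> 'h::real_normed_vector) \<Rightarrow> real" where
  "riesz_B h = Inf {B. riesz_upper h B}"

definition riesz_bases :: "real \<Rightarrow> (nat \<Rightarrow> 'h::real_normed_vector) set" where
  "riesz_bases C = {h. riesz_basis h \<and> riesz_B h / riesz_A h \<le> C}"

definition n_term_maps ::
    "(nat \<Rightarrow> 'h::real_normed_vector) \<Rightarrow> nat \<Rightarrow> ('f::real_normed_vector \<Rightarrow> 'h) set" where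
  "n_term_maps h n =
     {(\<lambda>f. \<Sum>k<n. c f k *\<^sub>R h (i f k)) | (c :: 'f \<Rightarrow> nat \<Rightarrow> real) (i :: 'f \<Rightarrow> nat \<Rightarrow> nat). True}"

definition e_non ::
    "('f::real_normed_vector \<Rightarrow> 'h::real_normed_vector) \<Rightarrow> real \<Rightarrow> nat \<Rightarrow> ennreal" where
  "e_non S C n = (INF h\<in>riesz_bases C. INF T\<in>n_term_maps h n. worst_case_error S T)"

(* dim Y = n + 1 forces Y to be finite-dimensional, since dim is 0 for infinite-dimensional
   subspaces.  If Y does not exist, or only r = 0 is admissible, the width is 0. *)
definition bernstein_width ::
    "('f::real_normed_vector \<Rightarrow> 'h::real_normed_vector) \<Rightarrow> nat \<Rightarrow> ennreal" where
  "bernstein_width S n =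
     Sup {ennreal r | r. r \<ge> 0 \<and>
       (\<exists>Y. subspace Y \<and> dim Y = n + 1 \<and> {y\<in>Y. norm y \<le> r} \<subseteq> S ` {f. norm f \<le> 1})}"

end

theory Submission
  imports Defs "HOL-Homology.Homology"
begin

text \<open>Since \<open>S\<close> is a bounded injection between Hilbert spaces, both \<open>e_lin S n\<close> and \<open>e_cont S n\<close> equal the
  Bernstein width \<open>b\<^sub>n\<close>. For \<open>e_lin S n \<le> b\<^sub>n\<close> an almost singular system is built greedily, without
  spectral theory, so that \<open>S\<close> need not be compact. For \<open>b\<^sub>n \<le> e_cont S n\<close>, an approximation of \<open>S\<close>
  through \<open>\<real>\<^sup>n\<close> with error less than the radius of an \<open>(n + 1)\<close>-dimensional ball would, after a small
  perturbation, be a map that is close to the identity on the sphere, hence onto a neighbourhood of 0,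
  while its range lies in a Lipschitz image of a bounded subset of \<open>\<real>\<^sup>n\<close>. An orthonormal basis adapted to
  a linear approximation gives \<open>e_non S C n \<le> e_lin S n\<close>, and an element of a \<open>(2 * n + 1)\<close>-dimensional
  space with \<open>2 * n + 1\<close> coefficients of maximal size gives \<open>b\<^sub>2\<^sub>n \<le> 4 * C * e_non S C n\<close>; the
  hypothesis on the Bernstein widths closes the circle.\<close>

text \<open>The group inverse of HOL-Algebra would make \<open>inv A\<close> ambiguous.\<close>

unbundle no m_inv_syntax

section \<open>Orthonormal systems\<close>

text \<open>A bounded \<open>S\<close> need not attain its norm, so exact singular vectors may not
  exist; since \<open>n\<close> is fixed before the errors are chosen, near-maximisers still give
  both equalities without a constant. The usual source of lower bounds for continuous approximation
  is Borsuk-Ulam. Here the non-contractible sphere and a counting argument take its place. The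
  decoder is only continuous, and a continuous image of an n-dimensional set may fill a ball of
  dimension n + 1; this forces the exchange for a Lipschitz map, whose image cannot. The index 2n
  appears for the nonlinear widths because the n selected terms must be a minority among
  coefficients of maximal size. In \<open>4 * C\<close>, the factor \<open>C\<close> comes from
  comparing norms through both Riesz constants, one factor 2 from keeping a quarter of the sum of
  squares, and the other 2 leaves room for the perturbation to finite combinations.\<close>

definition orthonormal_on :: "'i set \<Rightarrow> ('i \<Rightarrow> 'a::real_inner) \<Rightarrow> bool" where
  "orthonormal_on I e \<longleftrightarrow> (\<forall>i\<in>I. \<forall>j\<in>I. e i \<bullet> e j = (if i = j then 1 else 0))"

lemma orthonormal_onD:
  assumes "orthonormal_on I e" "i \<in> I" "j \<in> I"
  shows "e i \<bullet> e j = (if i = j then 1 else 0)"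
  using assms unfolding orthonormal_on_def by blast

lemma orthonormal_on_subset: "orthonormal_on I e \<Longrightarrow> J \<subseteq> I \<Longrightarrow> orthonormal_on J e"
  unfolding orthonormal_on_def by blast

lemma norm_orthonormal:
  assumes "orthonormal_on I e" "i \<in> I"
  shows "norm (e i) = 1"
  using orthonormal_onD[OF assms assms(2)] by (simp add: norm_eq_sqrt_inner)

lemma inner_sum_orthonormal:
  assumes "finite I" "orthonormal_on I e" "j \<in> I"
  shows "(\<Sum>i\<in>I. x i *\<^sub>R e i) \<bullet> e j = x j"
proof -
  have "(\<Sum>i\<in>I. x i *\<^sub>R e i) \<bullet> e j = (\<Sum>i\<in>I. if i = j then x i else 0)"
    unfolding inner_sum_left
    by (rule sum.cong) (use assms in \<open>auto simp: orthonormal_onD\<close>)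
  then show ?thesis using assms by simp
qed

lemma norm_sum_orthonormal:
  assumes "finite I" "orthonormal_on I e"
  shows "(norm (\<Sum>i\<in>I. x i *\<^sub>R e i))\<^sup>2 = (\<Sum>i\<in>I. (x i)\<^sup>2)"
proof -
  have "(norm (\<Sum>i\<in>I. x i *\<^sub>R e i))\<^sup>2 = (\<Sum>j\<in>I. x j * ((\<Sum>i\<in>I. x i *\<^sub>R e i) \<bullet> e j))"
    unfolding power2_norm_eq_inner by (subst inner_sum_right) simp
  also have "\<dots> = (\<Sum>j\<in>I. (x j)\<^sup>2)"
    by (rule sum.cong) (simp_all add: inner_sum_orthonormal[OF assms] power2_eq_square)
  finally show ?thesis .
qed

lemma inner_residual_orthonormal:
  assumes "finite I" "orthonormal_on I e" "j \<in> I"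
  shows "(y - (\<Sum>i\<in>I. (y \<bullet> e i) *\<^sub>R e i)) \<bullet> e j = 0"
  using inner_sum_orthonormal[OF assms, of "\<lambda>i. y \<bullet> e i"] by (simp add: inner_diff_left)

lemma norm_residual_orthonormal:
  assumes "finite I" "orthonormal_on I e"
  shows "(norm (y - (\<Sum>i\<in>I. (y \<bullet> e i) *\<^sub>R e i)))\<^sup>2 = (norm y)\<^sup>2 - (\<Sum>i\<in>I. (y \<bullet> e i)\<^sup>2)"
proof -
  let ?p = "\<Sum>i\<in>I. (y \<bullet> e i) *\<^sub>R e i"
  have "y \<bullet> ?p = (\<Sum>i\<in>I. (y \<bullet> e i)\<^sup>2)"
    by (simp add: inner_sum_right power2_eq_square)
  moreover have "?p \<bullet> ?p = (\<Sum>i\<in>I. (y \<bullet> e i)\<^sup>2)"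
    using norm_sum_orthonormal[OF assms, of "\<lambda>i. y \<bullet> e i"] by (simp add: power2_norm_eq_inner)
  ultimately show ?thesis
    by (simp add: power2_norm_eq_inner inner_diff_left inner_diff_right inner_commute)
qed

lemma bessel_inequality:
  assumes "finite I" "orthonormal_on I e"
  shows "(\<Sum>i\<in>I. (y \<bullet> e i)\<^sup>2) \<le> (norm y)\<^sup>2"
  using norm_residual_orthonormal[OF assms, of y]
    zero_le_power2[of "norm (y - (\<Sum>i\<in>I. (y \<bullet> e i) *\<^sub>R e i))"] by linarith

lemma in_span_orthonormal:
  assumes "finite I" "orthonormal_on I e" "y \<in> span (e ` I)"
  shows "(\<Sum>i\<in>I. (y \<bullet> e i) *\<^sub>R e i) = y"
  using assms(3)
proof (induction rule: span_induct)
  case base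
  then show ?case
    by (auto simp: subspace_def inner_add_left scaleR_add_left sum.distrib
        simp flip: scaleR_scaleR scaleR_sum_right)
next
  case (step y)
  then obtain j where j: "j \<in> I" "y = e j" by blast
  have "(\<Sum>i\<in>I. (y \<bullet> e i) *\<^sub>R e i) = (\<Sum>i\<in>I. if j = i then e i else 0)"
    by (rule sum.cong) (use assms j in \<open>auto simp: orthonormal_onD\<close>)
  then show ?case using j assms(1) by simp
qed

text \<open>The orthogonal projection is a finite sum of continuous maps, and the span is its
  fixed-point set; the argument works inside an infinite-dimensional space.\<close>

lemma closed_span_orthonormal:
  assumes "finite I" "orthonormal_on I e"
  shows "closed (span (e ` I))"
proof -
  have "span (e ` I) = {y. (\<Sum>i\<in>I. (y \<bullet> e i) *\<^sub>R e i) = y}"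
  proof (intro equalityI subsetI CollectI)
    fix y assume "y \<in> {y. (\<Sum>i\<in>I. (y \<bullet> e i) *\<^sub>R e i) = y}"
    then show "y \<in> span (e ` I)"
      by simp (metis (no_types, lifting) imageI span_base span_mul span_sum)
  qed (use in_span_orthonormal[OF assms] in auto)
  moreover have "closed {y. (\<Sum>i\<in>I. (y \<bullet> e i) *\<^sub>R e i) = y}"
    by (intro closed_Collect_eq continuous_intros)
  ultimately show ?thesis by simp
qed

lemma orthonormal_imp_inj_on: "orthonormal_on I e \<Longrightarrow> inj_on e I"
  unfolding orthonormal_on_def inj_on_def by (metis zero_neq_one)

lemma orthonormal_imp_independent:
  assumes "orthonormal_on I e"
  shows "independent (e ` I)"
proof (rule pairwise_orthogonal_independent)
  show "pairwise orthogonal (e ` I)"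
    using assms unfolding orthonormal_on_def pairwise_def orthogonal_def by auto
  show "0 \<notin> e ` I"
    using norm_orthonormal[OF assms] by force
qed

text \<open>The two span memberships serve different ends: the first keeps \<open>v\<close> inside
  any subspace that contains \<open>y\<close> and the system, the second guarantees that
  \<open>y\<close> is captured by the enlarged system.\<close>

lemma gram_schmidt_step:
  assumes "finite I" "orthonormal_on I e" "y \<notin> span (e ` I)"
  obtains v where "norm v = 1" "\<And>i. i \<in> I \<Longrightarrow> v \<bullet> e i = 0"
    "v \<in> span (insert y (e ` I))" "y \<in> span (insert v (e ` I))"
proof -
  define p where "p = (\<Sum>i\<in>I. (y \<bullet> e i) *\<^sub>R e i)"
  have p: "p \<in> span (e ` I)"
    unfolding p_def by (intro span_sum span_mul span_base) auto
  then have ne: "y - p \<noteq> 0" using assms(3) by auto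
  define v where "v = inverse (norm (y - p)) *\<^sub>R (y - p)"
  have sub: "span (e ` I) \<subseteq> span (insert z (e ` I))" for z
    by (intro span_mono) auto
  have "y = norm (y - p) *\<^sub>R v + p" using ne by (simp add: v_def)
  moreover have "norm (y - p) *\<^sub>R v + p \<in> span (insert v (e ` I))"
    using p sub by (intro span_add span_mul) (auto intro: span_base)
  moreover have "v \<in> span (insert y (e ` I))"
    unfolding v_def using p sub by (intro span_diff span_mul) (auto intro: span_base)
  moreover have "norm v = 1" using ne by (simp add: v_def)
  moreover have "v \<bullet> e i = 0" if "i \<in> I" for i
    using inner_residual_orthonormal[OF assms(1,2) that, of y] by (simp add: v_def p_def)
  ultimately show ?thesis using that by metis
qed

lemma orthonormal_on_extend:
  assumes "orthonormal_on {..<k} e" "norm v = 1" "\<And>i. i < k \<Longrightarrow> v \<bullet> e i = 0"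
  shows "orthonormal_on {..<Suc k} (e(k := v))"
proof -
  have "v \<bullet> v = 1" using assms(2) by (simp add: dot_square_norm)
  then show ?thesis
    using assms(1,3) unfolding orthonormal_on_def
    by (auto simp: less_Suc_eq inner_commute)
qed

lemma span_image_fun_upd_lessThan: "(e(k := v)) ` {..<Suc k} = insert v (e ` {..<k})"
  by (auto simp: lessThan_Suc image_iff)

lemma orthonormal_in_subspace:
  assumes "subspace Y" "n \<le> dim Y"
  obtains e :: "nat \<Rightarrow> 'a::real_inner" where "orthonormal_on {..<n} e" "e ` {..<n} \<subseteq> Y"
proof -
  have "\<exists>e :: nat \<Rightarrow> 'a. orthonormal_on {..<k} e \<and> e ` {..<k} \<subseteq> Y" if "k \<le> dim Y" for k
    using that
  proof (induction k)
    case 0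
    then show ?case by (simp add: orthonormal_on_def)
  next
    case (Suc k)
    then obtain e where e: "orthonormal_on {..<k} e" "e ` {..<k} \<subseteq> Y" by auto
    have "\<not> Y \<subseteq> span (e ` {..<k})"
    proof
      assume "Y \<subseteq> span (e ` {..<k})"
      then have "dim Y \<le> card (e ` {..<k})" by (simp add: dim_le_card)
      also have "\<dots> \<le> k" using card_image_le[of "{..<k}" e] by simp
      finally show False using Suc.prems by simp
    qed
    then obtain y where y: "y \<in> Y" "y \<notin> span (e ` {..<k})" by auto
    obtain v where v: "norm v = 1" "\<And>i. i \<in> {..<k} \<Longrightarrow> v \<bullet> e i = 0"
      "v \<in> span (insert y (e ` {..<k}))"
      using gram_schmidt_step[OF _ e(1) y(2)] by (metis finite_lessThan)
    have "v \<in> Y"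
      using v(3) span_minimal[of "insert y (e ` {..<k})" Y] e(2) y(1) assms(1) by blast
    then have "(e(k := v)) ` {..<Suc k} \<subseteq> Y"
      unfolding span_image_fun_upd_lessThan using e(2) by blast
    moreover have "orthonormal_on {..<Suc k} (e(k := v))"
      using orthonormal_on_extend[OF e(1) v(1)] v(2) by simp
    ultimately show ?case by blast
  qed
  then show ?thesis using that assms(2) by blast
qed

text \<open>The hypothesis makes the span of \<open>d\<close> infinite-dimensional, so an unspanned
  term is always available and the process yields an infinite system without zero vectors.\<close>

lemma gram_schmidt_sequence:
  fixes d :: "nat \<Rightarrow> 'a::real_inner"
  assumes "\<And>B. finite B \<Longrightarrow> \<not> range d \<subseteq> span B"
  obtains e :: "nat \<Rightarrow> 'a" where "orthonormal_on UNIV e" "\<And>k. d ` {..<k} \<subseteq> span (e ` {..<k})"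
proof -
  define P where
    "P k e \<longleftrightarrow> orthonormal_on {..<k} e \<and> d ` {..<k} \<subseteq> span (e ` {..<k})" for k and e :: "nat \<Rightarrow> 'a"
  have step: "\<exists>e'. P (Suc k) e' \<and> (\<forall>i<k. e' i = e i)" if P: "P k e" for k e
  proof -
    have on: "orthonormal_on {..<k} e" and dk: "d ` {..<k} \<subseteq> span (e ` {..<k})"
      using P by (auto simp: P_def)
    obtain m where m: "d m \<notin> span (e ` {..<k})" "\<And>l. l < m \<Longrightarrow> d l \<in> span (e ` {..<k})"
      using assms[of "e ` {..<k}"] exists_least_iff[of "\<lambda>m. d m \<notin> span (e ` {..<k})"] by blast
    obtain v where v: "norm v = 1" "\<And>i. i \<in> {..<k} \<Longrightarrow> v \<bullet> e i = 0"
      "d m \<in> span (insert v (e ` {..<k}))"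
      using gram_schmidt_step[OF _ on m(1)] by (metis finite_lessThan)
    \<comment> \<open>Since \<open>m\<close> is the first unspanned index and the first
      \<open>k\<close> terms are spanned, adding \<open>v\<close> covers all indices up to
      \<open>m\<close>, in particular index \<open>k\<close>.\<close>
    have "k \<le> m" using m(1) dk by (metis imageI lessThan_iff not_le_imp_less subsetD)
    have "d l \<in> span (insert v (e ` {..<k}))" if "l < Suc k" for l
    proof (cases "l = m")
      case False
      then have "l < m" using that \<open>k \<le> m\<close> by simp
      then show ?thesis using m(2) span_mono[of "e ` {..<k}" "insert v (e ` {..<k})"] by blast
    qed (use v in simp)
    then have "P (Suc k) (e(k := v))"
      unfolding P_def span_image_fun_upd_lessThan
      using orthonormal_on_extend[OF on v(1)] v(2) by auto
    then show ?thesis by (intro exI[of _ "e(k := v)"]) auto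
  qed
  have "\<exists>F. \<forall>k. P k (F k) \<and> (\<forall>i<k. F (Suc k) i = F k i)"
    by (rule dependent_nat_choice) (use step in \<open>auto simp: P_def orthonormal_on_def\<close>)
  then obtain F where F: "\<And>k. P k (F k)" "\<And>k i. i < k \<Longrightarrow> F (Suc k) i = F k i"
    by blast
  \<comment> \<open>\<open>F k\<close> is meaningful only below \<open>k\<close>, and consecutive
    prefixes agree; the diagonal joins them into one sequence.\<close>
  define e where "e i = F (Suc i) i" for i
  have Fe: "F k i = e i" if "i < k" for i k
    using that
  proof (induction k)
    case (Suc k)
    then show ?case by (cases "i = k") (auto simp: e_def F(2))
  qed simp
  have im: "F k ` {..<k} = e ` {..<k}" for k
    by (rule image_cong) (auto simp: Fe)
  show ?thesis
  proof (rule that)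
    show "orthonormal_on UNIV e"
      unfolding orthonormal_on_def
    proof (intro ballI)
      fix i j :: nat
      have "orthonormal_on {..<Suc (max i j)} (F (Suc (max i j)))"
        using F(1) by (auto simp: P_def)
      from orthonormal_onD[OF this, of i j] show "e i \<bullet> e j = (if i = j then 1 else 0)"
        by (simp add: Fe less_Suc_eq_le)
    qed
    show "d ` {..<k} \<subseteq> span (e ` {..<k})" for k
      using F(1)[of k] by (simp add: P_def im)
  qed
qed

lemma orthonormal_basis_extending:
  fixes h :: "nat \<Rightarrow> 'a::real_inner"
  assumes "separable_space (euclidean :: 'a topology)"
    and "\<not> (\<exists>B :: 'a set. finite B \<and> span B = UNIV)"
  obtains e :: "nat \<Rightarrow> 'a" where "orthonormal_on UNIV e" "closure (span (range e)) = UNIV"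
    "h ` {..<n} \<subseteq> span (e ` {..<n})"
proof -
  obtain D :: "'a set" where D: "countable D" "closure D = UNIV"
    using assms(1) by (auto simp: separable_space_def)
  then have "D \<noteq> {}" by auto
  \<comment> \<open>The vectors \<open>h i\<close> come first, so that the first \<open>n\<close>
    Gram-Schmidt vectors already span them; the dense sequence behind them makes the system
    complete.\<close>
  define d where "d i = (if i < n then h i else from_nat_into D (i - n))" for i
  have "D \<subseteq> range d"
  proof
    fix y assume "y \<in> D"
    then obtain i where "from_nat_into D i = y"
      using range_from_nat_into[OF \<open>D \<noteq> {}\<close> D(1)] by (metis imageE)
    then have "d (i + n) = y" by (simp add: d_def)
    then show "y \<in> range d" by blast
  qed
  have nospan: "\<not> range d \<subseteq> span B" if "finite B" for B
  proof
    \<comment> \<open>A finite-dimensional span is closed, so if it contained the dense set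
      \<open>D\<close> it would be the whole space. Closedness is known for orthonormal generators,
      hence the passage from \<open>B\<close> to \<open>e\<close>.\<close>
    assume B: "range d \<subseteq> span B"
    obtain e :: "nat \<Rightarrow> 'a" where e: "orthonormal_on {..<dim B} e" "e ` {..<dim B} \<subseteq> span B"
      using orthonormal_in_subspace[of "span B" "dim B"] by auto
    have cd: "card (e ` {..<dim B}) = dim B"
      using card_image[OF orthonormal_imp_inj_on[OF e(1)]] by simp
    have "span B \<subseteq> span (e ` {..<dim B})"
    proof
      fix x assume x: "x \<in> span B"
      show "x \<in> span (e ` {..<dim B})"
      proof (rule ccontr)
        assume nx: "x \<notin> span (e ` {..<dim B})"
        then have nin: "x \<notin> e ` {..<dim B}" by (meson span_base)
        have "independent (insert x (e ` {..<dim B}))"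
          using independent_insertI[OF nx orthonormal_imp_independent[OF e(1)]] .
        moreover obtain C where C: "C \<subseteq> B" "independent C" "B \<subseteq> span C" "card C = dim B"
          using basis_exists by blast
        then have "insert x (e ` {..<dim B}) \<subseteq> span C"
          using x e(2) by (metis insert_subset order_trans span_minimal subspace_span subsetD)
        moreover have "finite C" using C(1) \<open>finite B\<close> finite_subset by blast
        ultimately have "card (insert x (e ` {..<dim B})) \<le> dim B"
          using independent_span_bound[of C] C(4) by auto
        then show False using nin cd by simp
      qed
    qed
    then have "D \<subseteq> span (e ` {..<dim B})" using B \<open>D \<subseteq> range d\<close> by blast
    then have "closure D \<subseteq> span (e ` {..<dim B})"
      using closure_minimal closed_span_orthonormal[OF _ e(1)] by blast
    then show False using D(2) assms(2) by auto
  qed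
  obtain e :: "nat \<Rightarrow> 'a" where e: "orthonormal_on UNIV e" "\<And>k. d ` {..<k} \<subseteq> span (e ` {..<k})"
    using gram_schmidt_sequence[of d] nospan by blast
  have "d i \<in> span (range e)" for i
    using e(2)[of "Suc i"] span_mono[of "e ` {..<Suc i}" "range e"] by auto
  then have "D \<subseteq> span (range e)" using \<open>D \<subseteq> range d\<close> by auto
  then have "closure (span (range e)) = UNIV" using D(2) closure_mono by blast
  moreover have "h ` {..<n} = d ` {..<n}" by (rule image_cong) (auto simp: d_def)
  ultimately show ?thesis using that e by metis
qed

section \<open>Coefficient vectors with many extremal entries\<close>

text \<open>Gaussian elimination, by induction on the equations: either equation \<open>k\<close> is
  trivial on \<open>J\<close>, or it eliminates an unknown \<open>p\<close> whose coefficient in it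
  is nonzero.\<close>

lemma homogeneous_system_nontrivial:
  fixes a :: "'j \<Rightarrow> 'k \<Rightarrow> 'a::field"
  assumes "finite K" "finite J" "card K < card J"
  shows "\<exists>u. (\<exists>j\<in>J. u j \<noteq> 0) \<and> (\<forall>k\<in>K. (\<Sum>j\<in>J. u j * a j k) = 0)"
  using assms
proof (induction K arbitrary: J a rule: finite_induct)
  case empty
  then obtain j where "j \<in> J" by fastforce
  then show ?case by (intro exI[of _ "\<lambda>_. 1"]) auto
next
  case (insert k K)
  show ?case
  proof (cases "\<forall>j\<in>J. a j k = 0")
    case True
    have "card K < card J" using insert by simp
    from insert.IH[OF insert.prems(1) this] obtain u
      where u: "\<exists>j\<in>J. u j \<noteq> 0" "\<forall>k\<in>K. (\<Sum>j\<in>J. u j * a j k) = 0" by blast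
    then show ?thesis using True by (intro exI[of _ u]) auto
  next
    case False
    then obtain p where p: "p \<in> J" "a p k \<noteq> 0" by blast
    define b where "b j l = a j l - a j k / a p k * a p l" for j l
    have "card K < card (J - {p})" using insert p by simp
    then obtain u where u: "\<exists>j\<in>J - {p}. u j \<noteq> 0" "\<forall>l\<in>K. (\<Sum>j\<in>J - {p}. u j * b j l) = 0"
      using insert.IH[of "J - {p}" b] insert.prems by auto
    define s where "s = (\<Sum>j\<in>J - {p}. u j * (a j k / a p k))"
    \<comment> \<open>Back substitution: with this value at \<open>p\<close> the full system reduces
      to the one for \<open>b\<close>, in which equation \<open>k\<close> has only zero
      coefficients.\<close>
    define v where "v = u(p := - s)"
    have v: "(\<Sum>j\<in>J. v j * a j l) = (\<Sum>j\<in>J - {p}. u j * b j l)" for l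
    proof -
      have "(\<Sum>j\<in>J. v j * a j l) = v p * a p l + (\<Sum>j\<in>J - {p}. v j * a j l)"
        using p insert.prems(1) by (simp add: sum.remove)
      also have "(\<Sum>j\<in>J - {p}. v j * a j l) = (\<Sum>j\<in>J - {p}. u j * a j l)"
        by (rule sum.cong) (auto simp: v_def)
      also have "v p * a p l = - (\<Sum>j\<in>J - {p}. u j * (a j k / a p k) * a p l)"
        by (simp add: v_def s_def sum_distrib_right)
      finally show ?thesis
        by (simp add: b_def right_diff_distrib sum_subtractf mult.assoc)
    qed
    moreover have "(\<Sum>j\<in>J - {p}. u j * b j k) = 0"
      using p by (simp add: b_def)
    moreover have "\<exists>j\<in>J. v j \<noteq> 0" using u(1) by (auto simp: v_def)
    ultimately show ?thesis using u(2) by (intro exI[of _ v]) auto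
  qed
qed

text \<open>An extreme point of the unit ball of a \<open>card J\<close>-dimensional space of coordinate vectors,
  taken in the maximum norm, has at least \<open>card J\<close> coordinates of absolute value 1: otherwise it
  can be moved along a direction that vanishes at these coordinates.\<close>

lemma many_unit_coordinates:
  fixes a :: "'j \<Rightarrow> 'k \<Rightarrow> real"
  assumes "finite K" "finite J"
    and inj: "\<And>u. (\<And>k. k \<in> K \<Longrightarrow> (\<Sum>j\<in>J. u j * a j k) = 0) \<Longrightarrow> (\<And>j. j \<in> J \<Longrightarrow> u j = 0)"
  obtains t where "\<And>k. k \<in> K \<Longrightarrow> \<bar>\<Sum>j\<in>J. t j * a j k\<bar> \<le> 1"
    "card J \<le> card {k\<in>K. \<bar>\<Sum>j\<in>J. t j * a j k\<bar> = 1}"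
proof -
  define \<alpha> where "\<alpha> t k = (\<Sum>j\<in>J. t j * a j k)" for t k
  define E where "E t = {k\<in>K. \<bar>\<alpha> t k\<bar> = 1}" for t
  define adm where "adm t \<longleftrightarrow> (\<forall>k\<in>K. \<bar>\<alpha> t k\<bar> \<le> 1)" for t
  have "adm (\<lambda>_. 0)" by (simp add: adm_def \<alpha>_def)
  moreover have "card (E t) \<le> card K" for t
    unfolding E_def using assms(1) by (intro card_mono) auto
  \<comment> \<open>A maximal number of extremal coordinates replaces extremality of the point; the
    maximum exists because the number is bounded by \<open>card K\<close>.\<close>
  ultimately obtain t where t: "adm t" "\<And>t'. adm t' \<Longrightarrow> card (E t') \<le> card (E t)"
    using ex_has_greatest_nat[of adm "\<lambda>_. 0" "\<lambda>t. card (E t)" "Suc (card K)"]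
    by (auto simp: less_Suc_eq_le)
  have "card J \<le> card (E t)"
  proof (rule ccontr)
    assume "\<not> card J \<le> card (E t)"
    moreover have "finite (E t)" using assms(1) by (simp add: E_def)
    ultimately obtain u where u: "\<exists>j\<in>J. u j \<noteq> 0" "\<forall>k\<in>E t. \<alpha> u k = 0"
      using homogeneous_system_nontrivial[of "E t" J a] assms(2) by (auto simp: \<alpha>_def)
    define N where "N = {k\<in>K. \<alpha> u k \<noteq> 0}"
    have N: "finite N" "N \<noteq> {}" using assms(1) u(1) inj[of u] by (auto simp: N_def \<alpha>_def)
    \<comment> \<open>The time at which coordinate \<open>k\<close>, moving in direction
      \<open>u\<close>, reaches the end of \<open>[-1, 1]\<close> towards which it moves. At the
      smallest such time no coordinate has left the interval, and a new one has become
      extremal.\<close>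
    define \<sigma> where "\<sigma> k = (1 - sgn (\<alpha> u k) * \<alpha> t k) / \<bar>\<alpha> u k\<bar>" for k
    define s where "s = Min (\<sigma> ` N)"
    have "s \<in> \<sigma> ` N" unfolding s_def using N by (intro Min_in) auto
    then obtain m where m: "m \<in> N" "s = \<sigma> m" by blast
    have s_le: "s \<le> \<sigma> k" if "k \<in> N" for k
      unfolding s_def using N that by (intro Min_le) auto
    have sg: "sgn (\<alpha> u k) * \<alpha> t k \<le> 1" "- 1 \<le> sgn (\<alpha> u k) * \<alpha> t k" if "k \<in> K" for k
      using t(1) that by (auto simp: adm_def sgn_if abs_le_iff)
    have "0 \<le> s" using m sg(1)[of m] by (auto simp: \<sigma>_def N_def)
    define t' where "t' j = t j + s * u j" for j
    have \<alpha>t': "\<alpha> t' k = \<alpha> t k + s * \<alpha> u k" for k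
      by (simp add: \<alpha>_def t'_def distrib_right sum.distrib sum_distrib_left mult.assoc)
    have sgn_t': "sgn (\<alpha> u k) * \<alpha> t' k = sgn (\<alpha> u k) * \<alpha> t k + s * \<bar>\<alpha> u k\<bar>" for k
      by (simp add: \<alpha>t' distrib_left abs_sgn mult_ac)
    have abs_t': "\<bar>\<alpha> t' k\<bar> = \<bar>sgn (\<alpha> u k) * \<alpha> t' k\<bar>" if "k \<in> N" for k
      using that by (simp add: N_def abs_mult abs_sgn_eq)
    have "\<bar>\<alpha> t' k\<bar> \<le> 1" if k: "k \<in> K" for k
    proof (cases "k \<in> N")
      case True
      then have "s * \<bar>\<alpha> u k\<bar> \<le> 1 - sgn (\<alpha> u k) * \<alpha> t k"
        using s_le[OF True] by (simp add: \<sigma>_def N_def le_divide_eq)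
      moreover have "0 \<le> s * \<bar>\<alpha> u k\<bar>" using \<open>0 \<le> s\<close> by simp
      ultimately show ?thesis
        unfolding abs_t'[OF True] sgn_t' using sg[OF k] by linarith
    next
      case False
      then show ?thesis using k t(1) by (simp add: \<alpha>t' N_def adm_def)
    qed
    then have "adm t'" by (simp add: adm_def)
    moreover have "insert m (E t) \<subseteq> E t'"
    proof -
      have "s * \<bar>\<alpha> u m\<bar> = 1 - sgn (\<alpha> u m) * \<alpha> t m"
        using m by (simp add: \<sigma>_def N_def)
      then have "\<bar>\<alpha> t' m\<bar> = 1" unfolding abs_t'[OF m(1)] sgn_t' by simp
      then show ?thesis using m(1) u(2) by (auto simp: E_def N_def \<alpha>t')
    qed
    moreover have "m \<notin> E t" using m(1) u(2) by (auto simp: N_def)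
    moreover have "finite (E t')" using assms(1) by (simp add: E_def)
    ultimately have "card (E t) < card (E t')"
      by (intro psubset_card_mono) auto
    then show False using t(2)[OF \<open>adm t'\<close>] by simp
  qed
  then show ?thesis using that[of t] t(1) by (auto simp: adm_def E_def \<alpha>_def)
qed

section \<open>Maps close to the identity and Lipschitz images\<close>

text \<open>Rewrites the sphere as a subspace of the function type with its own topology, so that
  \<open>continuous_on\<close> can be used.\<close>

lemma nsphere_eq_top_of_set:
  "nsphere n = top_of_set {x. (\<Sum>i\<le>n. (x i)\<^sup>2) = 1 \<and> (\<forall>i>n. x i = 0)}"
  unfolding nsphere euclidean_product_topology ..

definition nsphere_normalize :: "nat \<Rightarrow> (nat \<Rightarrow> real) \<Rightarrow> nat \<Rightarrow> real" where
  "nsphere_normalize n y i = (if i \<le> n then y i / sqrt (\<Sum>j\<le>n. (y j)\<^sup>2) else 0)"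

text \<open>Radial projection turns a homotopy that avoids the origin into a homotopy of maps of the
  sphere.\<close>

lemma homotopic_nsphere_normalize:
  fixes G :: "real \<times> (nat \<Rightarrow> real) \<Rightarrow> nat \<Rightarrow> real"
  assumes cont: "\<And>i. i \<le> n \<Longrightarrow> continuous_on ({0..1} \<times> topspace (nsphere n)) (\<lambda>p. G p i)"
    and nz: "\<And>p. p \<in> {0..1} \<times> topspace (nsphere n) \<Longrightarrow> \<exists>i\<le>n. G p i \<noteq> 0"
  shows "homotopic_with (\<lambda>_. True) (nsphere n) (nsphere n) 
    (\<lambda>x. nsphere_normalize n (G (0, x))) (\<lambda>x. nsphere_normalize n (G (1, x)))"
proof -
  define S where "S = {x :: nat \<Rightarrow> real. (\<Sum>i\<le>n. (x i)\<^sup>2) = 1 \<and> (\<forall>i>n. x i = 0)}"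
  have nS: "nsphere n = top_of_set S" by (simp add: nsphere_eq_top_of_set S_def)
  have pos: "0 < (\<Sum>j\<le>n. (G p j)\<^sup>2)" if p: "p \<in> {0..1} \<times> S" for p
  proof -
    obtain i where "i \<le> n" "G p i \<noteq> 0" using nz[of p] p by (auto simp: nS)
    then show ?thesis by (intro sum_pos2[of _ i]) auto
  qed
  have "continuous_on ({0..1} \<times> S) (\<lambda>p. nsphere_normalize n (G p) i)" for i
  proof (cases "i \<le> n")
    case True
    have "continuous_on ({0..1} \<times> S) (\<lambda>p. G p i / sqrt (\<Sum>j\<le>n. (G p j)\<^sup>2))"
      using cont True pos by (intro continuous_intros) (auto simp: nS less_imp_neq[symmetric])
    then show ?thesis using True by (simp add: nsphere_normalize_def)
  qed (simp add: nsphere_normalize_def)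
  then have "continuous_on ({0..1} \<times> S) (\<lambda>p. nsphere_normalize n (G p))"
    by (intro continuous_on_coordinatewise_then_product)
  moreover have "nsphere_normalize n (G p) \<in> S" if "p \<in> {0..1} \<times> S" for p
  proof -
    have "(\<Sum>i\<le>n. (nsphere_normalize n (G p) i)\<^sup>2) = (\<Sum>i\<le>n. (G p i)\<^sup>2) / (\<Sum>j\<le>n. (G p j)\<^sup>2)"
      unfolding sum_divide_distrib
      by (rule sum.cong) (auto simp: nsphere_normalize_def power_divide sum_nonneg)
    then show ?thesis using pos[OF that] by (simp add: S_def nsphere_normalize_def)
  qed
  ultimately show ?thesis
    unfolding nS homotopic_with_def
    by (intro exI[of _ "\<lambda>p. nsphere_normalize n (G p)"]) auto
qed

text \<open>Without a zero, shrinking the sphere to its centre makes the normalised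
  \<open>\<psi>\<close> null-homotopic, while the segments from \<open>x\<close> to
  \<open>\<psi> x\<close> miss the origin and make it homotopic to the identity. The sphere would
  then be contractible, which is false also for \<open>n = 0\<close>, where it consists of two
  points.\<close>

lemma near_identity_on_sphere_has_zero:
  fixes \<psi> :: "(nat \<Rightarrow> real) \<Rightarrow> nat \<Rightarrow> real" and n :: nat
  defines "D \<equiv> {x. (\<Sum>i\<le>n. (x i)\<^sup>2) \<le> 1 \<and> (\<forall>i>n. x i = 0)}"
  assumes cont: "\<And>i. i \<le> n \<Longrightarrow> continuous_on D (\<lambda>x. \<psi> x i)"
    and near: "\<And>x. x \<in> D \<Longrightarrow> (\<Sum>i\<le>n. (x i)\<^sup>2) = 1 \<Longrightarrow> (\<Sum>i\<le>n. (\<psi> x i - x i)\<^sup>2) < 1"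
  shows "\<exists>x\<in>D. \<forall>i\<le>n. \<psi> x i = 0"
proof (rule ccontr)
  assume "\<not> ?thesis"
  then have nz: "\<exists>i\<le>n. \<psi> x i \<noteq> 0" if "x \<in> D" for x using that by blast
  let ?\<nu> = "nsphere_normalize n"
  let ?S = "topspace (nsphere n)"
  have S: "?S = {x. (\<Sum>i\<le>n. (x i)\<^sup>2) = 1 \<and> (\<forall>i>n. x i = 0)}"
    by (simp add: nsphere_eq_top_of_set)
  have SD: "?S \<subseteq> D" by (auto simp: S D_def)
  have coord: "continuous_on A (\<lambda>p. snd p i)" for A :: "(real \<times> (nat \<Rightarrow> real)) set" and i
    by (rule continuous_on_product_then_coordinatewise) (rule continuous_on_snd[OF continuous_on_id])
  have scale: "(\<lambda>p i. fst p * snd p i) ` ({0..1} \<times> ?S) \<subseteq> D"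
  proof clarify
    fix t :: real and x :: "nat \<Rightarrow> real" assume t: "t \<in> {0..1}" and x: "x \<in> ?S"
    have "(\<Sum>i\<le>n. (t * x i)\<^sup>2) = t\<^sup>2"
      using x by (simp add: S power_mult_distrib flip: sum_distrib_left)
    then show "(\<lambda>i. fst (t, x) * snd (t, x) i) \<in> D"
      using t x by (auto simp: S D_def abs_square_le_1)
  qed
  have cs: "continuous_on ({0..1} \<times> ?S) (\<lambda>p. (\<lambda>i. fst p * snd p i) :: nat \<Rightarrow> real)"
    by (intro continuous_on_coordinatewise_then_product continuous_intros coord)
  have "homotopic_with (\<lambda>_. True) (nsphere n) (nsphere n)
      (\<lambda>x. ?\<nu> (\<psi> (\<lambda>i. fst (0, x) * snd (0::real, x) i))) (\<lambda>x. ?\<nu> (\<psi> (\<lambda>i. fst (1, x) * snd (1::real, x) i)))"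
  proof (rule homotopic_nsphere_normalize[of n "\<lambda>p. \<psi> (\<lambda>i. fst p * snd p i)"])
    show "continuous_on ({0..1} \<times> ?S) (\<lambda>p. \<psi> (\<lambda>i. fst p * snd p i) j)" if "j \<le> n" for j
      using continuous_on_compose2[OF cont[OF that] cs scale] .
  qed (use nz scale in blast)
  then have h1: "homotopic_with (\<lambda>_. True) (nsphere n) (nsphere n)
      (\<lambda>x. ?\<nu> (\<psi> (\<lambda>_. 0))) (\<lambda>x. ?\<nu> (\<psi> x))"
    by simp
  have c\<psi>: "continuous_on ({0..1} \<times> ?S) (\<lambda>p. \<psi> (snd p) i)" if "i \<le> n" for i
    by (rule continuous_on_compose2[OF cont[OF that]]) (use SD in \<open>auto intro: continuous_on_snd[OF continuous_on_id]\<close>)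
  have "homotopic_with (\<lambda>_. True) (nsphere n) (nsphere n)
      (\<lambda>x. ?\<nu> (\<lambda>i. snd (0::real, x) i + fst (0, x) * (\<psi> (snd (0::real, x)) i - snd (0::real, x) i)))
      (\<lambda>x. ?\<nu> (\<lambda>i. snd (1::real, x) i + fst (1, x) * (\<psi> (snd (1::real, x)) i - snd (1::real, x) i)))"
  proof (rule homotopic_nsphere_normalize[of n "\<lambda>p i. snd p i + fst p * (\<psi> (snd p) i - snd p i)"])
    show "continuous_on ({0..1 :: real} \<times> ?S) (\<lambda>p. snd p i + fst p * (\<psi> (snd p) i - snd p i))"
      if "i \<le> n" for i
      by (intro continuous_intros coord c\<psi>[OF that])
    fix p assume p: "p \<in> {0..1 :: real} \<times> ?S"
    obtain t x where tx: "p = (t, x)" by fastforce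
    have t: "0 \<le> t" "t \<le> 1" and x: "x \<in> ?S" using p by (auto simp: tx)
    show "\<exists>i\<le>n. snd p i + fst p * (\<psi> (snd p) i - snd p i) \<noteq> 0"
    proof (rule ccontr)
      assume "\<not> ?thesis"
      \<comment> \<open>If the segment met the origin, the unit vector \<open>x\<close> would equal
        \<open>- t\<close> times a vector of norm less than 1, with \<open>t\<close> at most
        1.\<close>
      then have "\<And>i. i \<le> n \<Longrightarrow> x i = - (t * (\<psi> x i - x i))" by (auto simp: tx)
      then have "(\<Sum>i\<le>n. (x i)\<^sup>2) = (\<Sum>i\<le>n. (t * (\<psi> x i - x i))\<^sup>2)"
        by (intro sum.cong) (metis atMost_iff, metis atMost_iff power2_minus)
      then have "1 = t\<^sup>2 * (\<Sum>i\<le>n. (\<psi> x i - x i)\<^sup>2)"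
        using x by (simp add: S power_mult_distrib sum_distrib_left)
      also have "\<dots> \<le> 1 * (\<Sum>i\<le>n. (\<psi> x i - x i)\<^sup>2)"
        using t by (intro mult_right_mono) (auto simp: sum_nonneg abs_square_le_1)
      also have "\<dots> < 1" using near[of x] x SD by (auto simp: S)
      finally show False by simp
    qed
  qed
  then have h2: "homotopic_with (\<lambda>_. True) (nsphere n) (nsphere n) (\<lambda>x. ?\<nu> x) (\<lambda>x. ?\<nu> (\<psi> x))"
    by simp
  have "homotopic_with (\<lambda>_. True) (nsphere n) (nsphere n) (\<lambda>x. ?\<nu> x) (\<lambda>x. ?\<nu> (\<psi> (\<lambda>_. 0)))"
    using homotopic_with_trans[OF h2 homotopic_with_symD[OF h1]] .
  then have "homotopic_with (\<lambda>_. True) (nsphere n) (nsphere n) id (\<lambda>x. ?\<nu> (\<psi> (\<lambda>_. 0)))"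
  proof (rule homotopic_with_eq)
    show "id x = ?\<nu> x" if "x \<in> ?S" for x
      using that by (auto simp: S nsphere_normalize_def fun_eq_iff)
  qed auto
  then show False
    using non_contractible_space_nsphere[of n] by (auto simp: contractible_space_def)
qed

text \<open>Stone-Weierstrass for the algebra of Lipschitz functions: it is closed under products
  because continuous functions on the compact \<open>K\<close> are bounded, and the coordinates
  below \<open>n\<close> separate points because all others vanish on \<open>K\<close>.\<close>

lemma lipschitz_approximation:
  fixes K :: "(nat \<Rightarrow> real) set"
  assumes "compact K" "\<And>z i. z \<in> K \<Longrightarrow> n \<le> i \<Longrightarrow> z i = 0" "continuous_on K q" "0 < \<epsilon>"
  shows "\<exists>p L. continuous_on K p \<and> 0 \<le> L \<and> (\<forall>z\<in>K. \<bar>q z - p z\<bar> < \<epsilon>) \<and>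
    (\<forall>z\<in>K. \<forall>z'\<in>K. \<bar>p z - p z'\<bar> \<le> L * (\<Sum>i<n. \<bar>z i - z' i\<bar>))"
proof -
  define P where "P f \<longleftrightarrow> continuous_on K f \<and>
    (\<exists>L\<ge>0. \<forall>z\<in>K. \<forall>z'\<in>K. \<bar>f z - f z'\<bar> \<le> L * (\<Sum>i<n. \<bar>z i - z' i\<bar>))" for f :: "_ \<Rightarrow> real"
  have "\<exists>g. P g \<and> (\<forall>x\<in>K. \<bar>q x - g x\<bar> < \<epsilon>)"
  proof (rule Stone_Weierstrass_HOL)
    fix f g assume fg: "P f \<and> P g"
    obtain L M where L: "0 \<le> L" "\<forall>z\<in>K. \<forall>z'\<in>K. \<bar>f z - f z'\<bar> \<le> L * (\<Sum>i<n. \<bar>z i - z' i\<bar>)"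
      and M: "0 \<le> M" "\<forall>z\<in>K. \<forall>z'\<in>K. \<bar>g z - g z'\<bar> \<le> M * (\<Sum>i<n. \<bar>z i - z' i\<bar>)"
      using fg by (auto simp: P_def)
    have cont: "continuous_on K f" "continuous_on K g" using fg by (auto simp: P_def)
    have bnd: "\<exists>B\<ge>0. \<forall>z\<in>K. \<bar>h z\<bar> \<le> B" if "continuous_on K h" for h :: "_ \<Rightarrow> real"
    proof -
      obtain b where "\<forall>z\<in>K. \<bar>h z\<bar> \<le> b"
        using compact_imp_bounded[OF compact_continuous_image[OF \<open>continuous_on K h\<close> assms(1)]]
        by (auto simp: bounded_iff)
      then show ?thesis by (intro exI[of _ "max b 0"]) (auto simp: le_max_iff_disj)
    qed
    obtain B where B: "0 \<le> B" "\<forall>z\<in>K. \<bar>f z\<bar> \<le> B" using bnd[OF cont(1)] by blast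
    obtain C where C: "0 \<le> C" "\<forall>z\<in>K. \<bar>g z\<bar> \<le> C" using bnd[OF cont(2)] by blast
    have "\<bar>(f z + g z) - (f z' + g z')\<bar> \<le> (L + M) * (\<Sum>i<n. \<bar>z i - z' i\<bar>)"
      if "z \<in> K" "z' \<in> K" for z z'
      using L(2)[rule_format, OF that] M(2)[rule_format, OF that]
      by (simp add: distrib_right abs_le_iff)
    then show "P (\<lambda>x. f x + g x)"
      unfolding P_def using cont L(1) M(1)
      by (intro conjI exI[of _ "L + M"] continuous_intros) auto
    have "\<bar>f z * g z - f z' * g z'\<bar> \<le> (B * M + C * L) * (\<Sum>i<n. \<bar>z i - z' i\<bar>)"
      if zz: "z \<in> K" "z' \<in> K" for z z'
    proof -
      have "f z * g z - f z' * g z' = f z * (g z - g z') + g z' * (f z - f z')"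
        by (simp add: algebra_simps)
      then have "\<bar>f z * g z - f z' * g z'\<bar> \<le> \<bar>f z\<bar> * \<bar>g z - g z'\<bar> + \<bar>g z'\<bar> * \<bar>f z - f z'\<bar>"
        by (metis abs_mult abs_triangle_ineq)
      also have "\<dots> \<le> B * (M * (\<Sum>i<n. \<bar>z i - z' i\<bar>)) + C * (L * (\<Sum>i<n. \<bar>z i - z' i\<bar>))"
        using B C L M zz by (intro add_mono mult_mono) auto
      finally show ?thesis by (simp add: algebra_simps)
    qed
    then show "P (\<lambda>x. f x * g x)"
      unfolding P_def using cont L(1) M(1) B(1) C(1)
      by (intro conjI exI[of _ "B * M + C * L"] continuous_intros) auto
  next
    fix x y assume xy: "x \<in> K \<and> y \<in> K \<and> x \<noteq> y"
    then obtain i where i: "x i \<noteq> y i" by (auto simp: fun_eq_iff)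
    then have "i < n" using xy assms(2) by (metis not_le)
    then have "\<bar>z i - z' i\<bar> \<le> (\<Sum>i<n. \<bar>z i - z' i\<bar>)" for z z' :: "nat \<Rightarrow> real"
      by (intro member_le_sum) auto
    then have "P (\<lambda>z. z i)"
      unfolding P_def
      by (intro conjI exI[of _ 1]) (auto intro: continuous_on_subset[OF continuous_on_product_coordinates])
    then show "\<exists>f. P f \<and> f x \<noteq> f y" using i by blast
  qed (use assms in \<open>auto simp: P_def intro: exI[of _ 0]\<close>)
  then show ?thesis unfolding P_def by blast
qed

text \<open>Dimension count: on the \<open>n\<close>-dimensional set \<open>K\<close> there are too few grid cells to reach all
  points of a sufficiently fine grid in the \<open>(n + 1)\<close>-dimensional cube.\<close>

lemma lipschitz_image_misses_cube_point:
  fixes K :: "(nat \<Rightarrow> real) set" and p :: "nat \<Rightarrow> (nat \<Rightarrow> real) \<Rightarrow> real"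
  assumes bound: "\<And>z i. z \<in> K \<Longrightarrow> i < n \<Longrightarrow> \<bar>z i\<bar> \<le> M" and "0 \<le> L" "0 < \<epsilon>"
    and lip: "\<And>j z z'. j \<le> n \<Longrightarrow> z \<in> K \<Longrightarrow> z' \<in> K \<Longrightarrow> \<bar>p j z - p j z'\<bar> \<le> L * (\<Sum>i<n. \<bar>z i - z' i\<bar>)"
  shows "\<exists>w. (\<forall>j\<le>n. \<bar>w j\<bar> \<le> \<epsilon>) \<and> \<not> (\<exists>z\<in>K. \<forall>j\<le>n. p j z = w j)"
proof (rule ccontr)
  assume "\<not> ?thesis"
  then have hit: "\<exists>z\<in>K. \<forall>j\<le>n. p j z = w j" if "\<And>j. j \<le> n \<Longrightarrow> \<bar>w j\<bar> \<le> \<epsilon>" for w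
    using that by blast
  define M' where "M' = max M 0"
  have M': "0 \<le> M'" "\<And>z i. z \<in> K \<Longrightarrow> i < n \<Longrightarrow> \<bar>z i\<bar> \<le> M'"
    using bound by (fastforce simp: M'_def)+
  \<comment> \<open>Along each axis \<open>K\<close> meets at most \<open>q * c + 1\<close> cells of
    side \<open>\<delta>\<close>, and \<open>q = (c + 1) ^ n\<close> is so large that
    \<open>(q * c + 1) ^ n < (q + 1) ^ (n + 1)\<close>: fewer cells than grid points.\<close>
  define c where "c = nat \<lceil>2 * M' * (L * n + 1) / \<epsilon>\<rceil>"
  define q where "q = (c + 1) ^ n"
  have "0 < q" by (simp add: q_def)
  \<comment> \<open>Two points of \<open>K\<close> in one cell have images that differ in each
    coordinate by less than the mesh width \<open>\<epsilon> / q\<close>. The summand 1 makes this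
    strict and keeps the denominator positive when \<open>L * n\<close> is 0.\<close>
  define \<delta> where "\<delta> = \<epsilon> / (q * (L * n + 1))"
  have Ln: "0 < L * n + 1" using assms(2) by (simp add: add_nonneg_pos)
  have \<delta>: "0 < \<delta>" using \<open>0 < q\<close> \<open>0 < \<epsilon>\<close> Ln by (simp add: \<delta>_def)
  have L\<delta>: "L * (n * \<delta>) < \<epsilon> / q"
  proof -
    have "(L * n + 1) * \<delta> = \<epsilon> / q" using Ln unfolding \<delta>_def by simp
    then show ?thesis using \<delta> by (simp add: algebra_simps)
  qed
  let ?A = "PiE {..n} (\<lambda>_. {..q})"
  have "\<exists>z\<in>K. \<forall>j\<le>n. p j z = \<epsilon> * a j / q" if "a \<in> ?A" for a
  proof (rule hit)
    fix j assume "j \<le> n"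
    then have "a j \<le> q" using that by (auto simp: PiE_def Pi_def)
    then have "\<epsilon> * a j \<le> \<epsilon> * q" using \<open>0 < \<epsilon>\<close> by simp
    then show "\<bar>\<epsilon> * a j / q\<bar> \<le> \<epsilon>" using \<open>0 < q\<close> \<open>0 < \<epsilon>\<close> by (simp add: divide_le_eq)
  qed
  then obtain Z where Z: "\<And>a. a \<in> ?A \<Longrightarrow> Z a \<in> K" "\<And>a j. a \<in> ?A \<Longrightarrow> j \<le> n \<Longrightarrow> p j (Z a) = \<epsilon> * a j / q"
    by metis
  define cell where "cell z = restrict (\<lambda>i. nat \<lfloor>(z i + M') / \<delta>\<rfloor>) {..<n}" for z :: "nat \<Rightarrow> real"
  let ?B = "PiE {..<n} (\<lambda>_. {..q * c})"
  have "inj_on (cell \<circ> Z) ?A"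
  proof (rule inj_onI)
    fix a b assume a: "a \<in> ?A" and b: "b \<in> ?A" and ab: "(cell \<circ> Z) a = (cell \<circ> Z) b"
    have close: "\<bar>Z a i - Z b i\<bar> \<le> \<delta>" if i: "i < n" for i
    proof -
      have "nat \<lfloor>(Z a i + M') / \<delta>\<rfloor> = nat \<lfloor>(Z b i + M') / \<delta>\<rfloor>"
        using fun_cong[OF ab, of i] i by (simp add: cell_def)
      moreover have "0 \<le> (Z a i + M') / \<delta>" "0 \<le> (Z b i + M') / \<delta>"
        using M'(2)[OF Z(1)[OF a] i] M'(2)[OF Z(1)[OF b] i] \<delta> by (auto simp: abs_le_iff)
      ultimately have "\<lfloor>(Z a i + M') / \<delta>\<rfloor> = \<lfloor>(Z b i + M') / \<delta>\<rfloor>"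
        by (simp add: eq_nat_nat_iff)
      then have "\<bar>(Z a i + M') / \<delta> - (Z b i + M') / \<delta>\<bar> \<le> 1"
        by linarith
      then have "\<bar>(Z a i - Z b i) / \<delta>\<bar> \<le> 1" by (simp add: diff_divide_distrib add_divide_distrib)
      then show ?thesis using \<delta> by (simp add: abs_divide divide_le_eq)
    qed
    have "a j = b j" if j: "j \<le> n" for j
    proof (rule ccontr)
      assume "a j \<noteq> b j"
      then have "1 \<le> \<bar>real (a j) - real (b j)\<bar>" by linarith
      then have "\<epsilon> / q \<le> \<epsilon> / q * \<bar>real (a j) - real (b j)\<bar>"
        using \<open>0 < \<epsilon>\<close> \<open>0 < q\<close> by (simp add: divide_right_mono)
      also have "\<dots> = \<bar>\<epsilon> / q * (real (a j) - real (b j))\<bar>"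
        using \<open>0 < \<epsilon>\<close> by (simp add: abs_mult)
      also have "\<dots> = \<bar>p j (Z a) - p j (Z b)\<bar>"
        by (simp add: Z(2)[OF a j] Z(2)[OF b j] algebra_simps diff_divide_distrib)
      also have "\<dots> \<le> L * (\<Sum>i<n. \<bar>Z a i - Z b i\<bar>)" using lip[OF j Z(1)[OF a] Z(1)[OF b]] .
      also have "\<dots> \<le> L * (n * \<delta>)"
        using sum_bounded_above[of "{..<n}" "\<lambda>i. \<bar>Z a i - Z b i\<bar>" \<delta>] close \<open>0 \<le> L\<close>
        by (intro mult_left_mono) auto
      finally show False using L\<delta> by simp
    qed
    then show "a = b" using a b by (intro PiE_ext[OF a b]) auto
  qed
  moreover have "(cell \<circ> Z) ` ?A \<subseteq> ?B"
  proof clarify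
    fix a assume a: "a \<in> ?A"
    have "nat \<lfloor>(Z a i + M') / \<delta>\<rfloor> \<le> q * c" if i: "i < n" for i
    proof -
      have "(Z a i + M') / \<delta> \<le> 2 * M' / \<delta>"
        using M'(2)[OF Z(1)[OF a] i] \<delta> by (intro divide_right_mono) (auto simp: abs_le_iff)
      also have "\<dots> = q * (2 * M' * (L * n + 1) / \<epsilon>)"
        using Ln \<open>0 < \<epsilon>\<close> by (simp add: \<delta>_def)
        also have "\<dots> \<le> real q * real c"
        unfolding c_def by (intro mult_left_mono real_nat_ceiling_ge) auto
      finally have "(Z a i + M') / \<delta> \<le> real (q * c)" by simp
      then show ?thesis by linarith
    qed
    then show "(cell \<circ> Z) a \<in> ?B" by (auto simp: cell_def)
  qed
  moreover have "finite ?B" by (simp add: finite_PiE)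
  ultimately have "card ?A \<le> card ?B" by (rule card_inj_on_le)
  then have "(q + 1) ^ (n + 1) \<le> (q * c + 1) ^ n" by (simp add: card_PiE)
  also have "\<dots> \<le> ((q + 1) * (c + 1)) ^ n" by (intro power_mono) auto
  also have "\<dots> = (q + 1) ^ n * q" unfolding power_mult_distrib q_def[symmetric] ..
  finally show False by simp
qed

text \<open>The function type carries the product topology, so compactness comes from Tychonoff: the
  ball is closed in a product of compact intervals.\<close>

lemma compact_coordinate_ball: "compact {x :: nat \<Rightarrow> real. (\<Sum>i\<le>n. (x i)\<^sup>2) \<le> 1 \<and> (\<forall>i>n. x i = 0)}"
proof -
  let ?D = "{x :: nat \<Rightarrow> real. (\<Sum>i\<le>n. (x i)\<^sup>2) \<le> 1 \<and> (\<forall>i>n. x i = 0)}"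
  let ?C = "PiE UNIV (\<lambda>_ :: nat. {- 1..1 :: real})"
  have "compactin (product_topology (\<lambda>_ :: nat. euclideanreal) UNIV) ?C"
    by (subst compactin_PiE) auto
  then have C: "compact ?C" by (simp add: euclidean_product_topology)
  have sub: "?D \<subseteq> ?C"
  proof
    fix x assume x: "x \<in> ?D"
    have "- 1 \<le> x i \<and> x i \<le> 1" for i
    proof (cases "i \<le> n")
      case True
      then have "(x i)\<^sup>2 \<le> (\<Sum>i\<le>n. (x i)\<^sup>2)" by (intro member_le_sum) auto
      then have "\<bar>x i\<bar> \<le> 1" using x abs_square_le_1[of "x i"] by auto
      then show ?thesis by linarith
    qed (use x in auto)
    then show "x \<in> ?C" by auto
  qed
  have D: "closed ?D"
  proof -
    have 1: "closed {x :: nat \<Rightarrow> real. (\<Sum>i\<le>n. (x i)\<^sup>2) \<le> 1}"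
      by (rule closed_Collect_le) (intro continuous_on_sum continuous_on_power
          continuous_on_product_coordinates, rule continuous_on_const)
    have 2: "closed (\<Inter>i\<in>{n<..}. {x :: nat \<Rightarrow> real. x i = 0})"
      by (intro closed_INT ballI closed_Collect_eq continuous_on_product_coordinates continuous_on_const)
    have "?D = {x. (\<Sum>i\<le>n. (x i)\<^sup>2) \<le> 1} \<inter> (\<Inter>i\<in>{n<..}. {x. x i = 0})"
      by auto
    then show ?thesis using closed_Int[OF 1 2] by (simp only:)
  qed
  show ?thesis
    using compact_Int_closed[OF C D] unfolding Int_absorb1[OF sub] .
qed

section \<open>Linear widths\<close>

lemma worst_case_error_le_iff:
  assumes "0 \<le> s"
  shows "worst_case_error S T \<le> ennreal s \<longleftrightarrow> (\<forall>f. norm f \<le> 1 \<longrightarrow> norm (S f - T f) \<le> s)"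
  using assms by (auto simp: worst_case_error_def SUP_le_iff)

lemma linear_maps_mono:
  assumes "k \<le> n"
  shows "linear_maps k \<subseteq> linear_maps n"
proof
  fix T :: "'f::real_normed_vector \<Rightarrow> 'h::real_normed_vector" assume "T \<in> linear_maps k"
  then obtain L h where T: "T = (\<lambda>f. \<Sum>i<k. L i f *\<^sub>R h i)" and L: "\<forall>i<k. bounded_linear (L i)"
    by (auto simp: linear_maps_def)
  define L' where "L' i = (if i < k then L i else (\<lambda>_. 0))" for i
  have "T f = (\<Sum>i<n. L' i f *\<^sub>R h i)" for f
    unfolding T by (rule sum.mono_neutral_cong_left) (use assms in \<open>auto simp: L'_def\<close>)
  moreover have "\<forall>i<n. bounded_linear (L' i)"
    using L by (auto simp: L'_def bounded_linear_zero)
  ultimately show "T \<in> linear_maps n" unfolding linear_maps_def by blast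
qed

lemma e_lin_antimono: "k \<le> n \<Longrightarrow> e_lin S n \<le> e_lin S k"
  unfolding e_lin_def by (intro INF_superset_mono linear_maps_mono) auto

text \<open>\<open>S\<close> after the projection to the span of the \<open>x i\<close> competes in
  \<open>e_lin S k\<close>, so its error exceeds \<open>s\<close> at some \<open>f\<close>. The part
  of \<open>f\<close> orthogonal to the system carries this error, and normalising that part does
  not shrink its image.\<close>

lemma large_image_in_complement:
  fixes S :: "'f::real_inner \<Rightarrow> 'h::real_inner"
  assumes "bounded_linear S" "orthonormal_on {..<k} x" "0 \<le> s" "ennreal s < e_lin S k"
  obtains g where "norm g = 1" "\<And>i. i < k \<Longrightarrow> g \<bullet> x i = 0" "s < norm (S g)"
proof -
  interpret S: bounded_linear S by fact
  let ?T = "\<lambda>f. \<Sum>i<k. (f \<bullet> x i) *\<^sub>R S (x i)"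
  have "?T \<in> linear_maps k"
    unfolding linear_maps_def
    by (intro CollectI exI[of _ "\<lambda>i f. f \<bullet> x i"] exI[of _ "\<lambda>i. S (x i)"])
      (simp add: bounded_linear_inner_left)
  then have "e_lin S k \<le> worst_case_error S ?T" unfolding e_lin_def by (rule INF_lower)
  then have "\<not> worst_case_error S ?T \<le> ennreal s" using assms(4) by simp
  then obtain f where f: "norm f \<le> 1" "s < norm (S f - ?T f)"
    using worst_case_error_le_iff[OF assms(3), of S ?T] by (auto simp: not_le)
  define g where "g = f - (\<Sum>i<k. (f \<bullet> x i) *\<^sub>R x i)"
  have Sg: "S g = S f - ?T f" by (simp add: g_def S.diff S.sum S.scale)
  have "(norm g)\<^sup>2 \<le> (norm f)\<^sup>2"
    unfolding g_def norm_residual_orthonormal[OF finite_lessThan assms(2)] by (simp add: sum_nonneg)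
  then have g1: "norm g \<le> 1" using f(1) by (meson norm_ge_zero order_trans power2_le_imp_le)
  have "g \<noteq> 0" using f(2) assms(3) Sg S.zero by force
  show ?thesis
  proof (rule that)
    show "norm (inverse (norm g) *\<^sub>R g) = 1" using \<open>g \<noteq> 0\<close> by simp
    show "(inverse (norm g) *\<^sub>R g) \<bullet> x i = 0" if "i < k" for i
      using inner_residual_orthonormal[OF _ assms(2), of i f] that by (simp add: g_def)
    have "1 \<le> inverse (norm g)" using g1 \<open>g \<noteq> 0\<close> by (simp add: one_le_inverse_iff)
    from mult_right_mono[OF this norm_ge_zero[of "S g"]]
    have "norm (S g) \<le> inverse (norm g) * norm (S g)" by simp
    then show "s < norm (S (inverse (norm g) *\<^sub>R g))"
      using f(2) Sg by (simp add: S.scale)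
  qed
qed

text \<open>If \<open>v\<close> almost maximises \<open>norm (S v)\<close> over the unit vectors of a subspace, then the Cauchy-Schwarz
  inequality for the positive form \<open>\<sigma>\<^sup>2 * (u \<bullet> y) - S u \<bullet> S y\<close> makes \<open>S v\<close> almost orthogonal to the
  image of the orthogonal complement of \<open>v\<close> in that subspace.\<close>

lemma almost_maximizer_in_complement:
  fixes S :: "'f::real_inner \<Rightarrow> 'h::real_inner"
  assumes "bounded_linear S" "orthonormal_on {..<k} x" "0 \<le> s" "ennreal s < e_lin S k" "0 < \<eta>"
  obtains v where "norm v = 1" "\<And>i. i < k \<Longrightarrow> v \<bullet> x i = 0" "s < norm (S v)"
    "\<And>y. (\<And>i. i < k \<Longrightarrow> y \<bullet> x i = 0) \<Longrightarrow> y \<bullet> v = 0 \<Longrightarrow> \<bar>S v \<bullet> S y\<bar> \<le> \<eta> * norm y"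
proof -
  interpret S: bounded_linear S by fact
  define V where "V = {g. \<forall>i<k. g \<bullet> x i = 0}"
  define U where "U = (\<lambda>g. norm (S g)) ` {g\<in>V. norm g = 1}"
  obtain g where g: "norm g = 1" "\<And>i. i < k \<Longrightarrow> g \<bullet> x i = 0" "s < norm (S g)"
    using large_image_in_complement[OF assms(1-4)] by blast
  then have gU: "norm (S g) \<in> U" by (auto simp: U_def V_def)
  obtain b where b: "\<And>y. norm (S y) \<le> norm y * b" using S.bounded by blast
  then have bdd: "bdd_above U" unfolding U_def
    by (intro bdd_aboveI[of _ b]) (auto intro: order_trans[OF b])
  define \<sigma> where "\<sigma> = Sup U"
  have "s < \<sigma>" using g(3) cSup_upper[OF gU bdd] by (simp add: \<sigma>_def)
  then have "0 < \<sigma>" using assms(3) by simp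
  have le_\<sigma>: "norm (S y) \<le> \<sigma> * norm y" if y: "y \<in> V" for y
  proof (cases "y = 0")
    case False
    then have "norm (S (inverse (norm y) *\<^sub>R y)) \<in> U"
      using y by (auto simp: U_def V_def)
    then have "norm (S (inverse (norm y) *\<^sub>R y)) \<le> \<sigma>"
      unfolding \<sigma>_def using bdd by (rule cSup_upper)
    then show ?thesis using False by (simp add: S.scale field_simps)
  qed simp
  \<comment> \<open>Cauchy-Schwarz will bound \<open>(S v \<bullet> S y)\<^sup>2\<close> by
    \<open>\<delta> * \<sigma>\<^sup>2 * (norm y)\<^sup>2\<close>; this \<open>\<delta>\<close>
    turns the bound into \<open>(\<eta> * norm y)\<^sup>2\<close>. It may exceed
    \<open>\<sigma>\<^sup>2\<close>, hence the truncation at 0 under the root below.\<close>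
  define \<delta> where "\<delta> = (\<eta> / \<sigma>)\<^sup>2"
  have "0 < \<delta>" using \<open>0 < \<eta>\<close> \<open>0 < \<sigma>\<close> by (simp add: \<delta>_def)
  have "sqrt (max 0 (\<sigma>\<^sup>2 - \<delta>)) < \<sigma>"
    using \<open>0 < \<delta>\<close> \<open>0 < \<sigma>\<close> by (intro real_less_lsqrt) auto
  then have "max s (sqrt (max 0 (\<sigma>\<^sup>2 - \<delta>))) < Sup U" using \<open>s < \<sigma>\<close> by (simp add: \<sigma>_def)
  then obtain z where z: "z \<in> U" "max s (sqrt (max 0 (\<sigma>\<^sup>2 - \<delta>))) < z"
    using less_cSupD[of U] gU by (metis empty_iff)
  then obtain v where v: "v \<in> V" "norm v = 1" "s < norm (S v)"
    "sqrt (max 0 (\<sigma>\<^sup>2 - \<delta>)) < norm (S v)"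
    by (auto simp: U_def)
  have "max 0 (\<sigma>\<^sup>2 - \<delta>) < (norm (S v))\<^sup>2"
    using v(4) by (meson norm_ge_zero not_le real_sqrt_le_iff real_le_rsqrt real_less_rsqrt order.strict_trans2 sqrt_le_D)
  then have Sv: "\<sigma>\<^sup>2 - \<delta> \<le> (norm (S v))\<^sup>2" by simp
  show ?thesis
  proof (rule that[OF v(2) _ v(3)])
    show "v \<bullet> x i = 0" if "i < k" for i using v(1) that by (simp add: V_def)
    fix y assume y: "\<And>i. i < k \<Longrightarrow> y \<bullet> x i = 0" and yv: "y \<bullet> v = 0"
    define p where "p = S v \<bullet> S y"
    show "\<bar>S v \<bullet> S y\<bar> \<le> \<eta> * norm y"
    proof (cases "y = 0")
      case False
      define w where "w = \<sigma>\<^sup>2 * (norm y)\<^sup>2"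
      have w: "0 < w" using False \<open>0 < \<sigma>\<close> by (simp add: w_def)
      \<comment> \<open>The choice for which \<open>2 * t * p \<le> \<delta> + t\<^sup>2 * w\<close>
        is sharpest; it gives \<open>p\<^sup>2 \<le> \<delta> * w\<close>.\<close>
      define t where "t = p / w"
      have "v + t *\<^sub>R y \<in> V" using v(1) y by (simp add: V_def inner_add_left)
      then have 1: "(norm (S (v + t *\<^sub>R y)))\<^sup>2 \<le> (\<sigma> * norm (v + t *\<^sub>R y))\<^sup>2"
        by (intro power_mono le_\<sigma>) auto
      have 2: "(norm (v + t *\<^sub>R y))\<^sup>2 = 1 + t\<^sup>2 * (norm y)\<^sup>2"
        unfolding power2_norm_eq_inner using v(2) yv
        by (simp add: inner_add_left inner_add_right inner_commute power2_eq_square norm_eq_1)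
      have 3: "(norm (S (v + t *\<^sub>R y)))\<^sup>2 = (norm (S v))\<^sup>2 + 2 * t * p + t\<^sup>2 * (norm (S y))\<^sup>2"
        unfolding power2_norm_eq_inner p_def
        by (simp add: S.add S.scale inner_add_left inner_add_right inner_commute power2_eq_square)
      have 4: "0 \<le> t\<^sup>2 * (norm (S y))\<^sup>2" by simp
      have 5: "\<sigma>\<^sup>2 * (1 + t\<^sup>2 * (norm y)\<^sup>2) = \<sigma>\<^sup>2 + t\<^sup>2 * w"
        by (simp add: w_def algebra_simps)
      have "2 * t * p \<le> \<delta> + t\<^sup>2 * w"
        using 1 4 Sv unfolding power_mult_distrib 2 3 5 by linarith
      then have "p\<^sup>2 \<le> \<delta> * w"
        using w by (simp add: t_def field_simps power2_eq_square)
      also have "\<dots> = (\<eta> * norm y)\<^sup>2"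
        using \<open>0 < \<sigma>\<close> by (simp add: \<delta>_def w_def power_divide power_mult_distrib)
      finally show ?thesis
        using \<open>0 < \<eta>\<close> unfolding p_def by (simp add: abs_le_square_iff[symmetric])
    qed simp
  qed
qed

text \<open>Each vector almost maximises over the complement of its predecessors. Its
  almost-orthogonality is recorded in \<open>P\<close> against every \<open>y\<close> orthogonal to
  it and to them, because the later vectors are not yet known at that stage.\<close>

lemma almost_singular_system:
  fixes S :: "'f::real_inner \<Rightarrow> 'h::real_inner"
  assumes "bounded_linear S" "0 \<le> s" "ennreal s < e_lin S n" "0 < \<eta>"
  obtains x :: "nat \<Rightarrow> 'f" where "orthonormal_on {..n} x" "\<And>i. i \<le> n \<Longrightarrow> s < norm (S (x i))"
    "\<And>i j. i \<le> n \<Longrightarrow> j \<le> n \<Longrightarrow> i \<noteq> j \<Longrightarrow> \<bar>S (x i) \<bullet> S (x j)\<bar> \<le> \<eta>"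
proof -
  define P where "P k x \<longleftrightarrow> orthonormal_on {..<k} x \<and> (\<forall>i<k. s < norm (S (x i))) \<and>
    (\<forall>i<k. \<forall>y. (\<forall>l\<le>i. y \<bullet> x l = 0) \<longrightarrow> \<bar>S (x i) \<bullet> S y\<bar> \<le> \<eta> * norm y)" for k and x :: "nat \<Rightarrow> 'f"
  have "\<exists>x. P k x" if "k \<le> Suc n" for k
    using that
  proof (induction k)
    case 0
    then show ?case by (simp add: P_def orthonormal_on_def)
  next
    case (Suc k)
    then obtain x where x: "P k x" by auto
    have "ennreal s < e_lin S k"
      using assms(3) e_lin_antimono[of k n S] Suc.prems by simp
    moreover have on: "orthonormal_on {..<k} x" using x by (simp add: P_def)
    ultimately obtain v where v: "norm v = 1" "\<And>i. i < k \<Longrightarrow> v \<bullet> x i = 0" "s < norm (S v)"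
      "\<And>y. (\<And>i. i < k \<Longrightarrow> y \<bullet> x i = 0) \<Longrightarrow> y \<bullet> v = 0 \<Longrightarrow> \<bar>S v \<bullet> S y\<bar> \<le> \<eta> * norm y"
      using almost_maximizer_in_complement[OF assms(1) _ assms(2) _ assms(4), of k x] by blast
    have "\<bar>S ((x(k := v)) i) \<bullet> S y\<bar> \<le> \<eta> * norm y"
      if i: "i < Suc k" and y: "\<forall>l\<le>i. y \<bullet> (x(k := v)) l = 0" for i y
    proof (cases "i = k")
      case True
      have "y \<bullet> x l = 0" if "l < k" for l using y[rule_format, of l] that True by simp
      moreover have "y \<bullet> v = 0" using y[rule_format, of k] True by simp
      ultimately show ?thesis using v(4) True by simp
    next
      case False
      then have "i < k" using i by simp
      moreover have "\<forall>l\<le>i. y \<bullet> x l = 0"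
      proof (intro allI impI)
        fix l assume "l \<le> i"
        then show "y \<bullet> x l = 0" using y[rule_format, of l] \<open>i < k\<close> by simp
      qed
      ultimately show ?thesis using x by (simp add: P_def)
    qed
    moreover have "\<forall>i<Suc k. s < norm (S ((x(k := v)) i))"
      using x v(3) by (auto simp: P_def less_Suc_eq)
    ultimately have "P (Suc k) (x(k := v))"
      unfolding P_def using orthonormal_on_extend[OF on v(1,2)] by blast
    then show ?case by blast
  qed
  then obtain x where x: "P (Suc n) x" by blast
  then have on: "orthonormal_on {..n} x" by (simp add: P_def lessThan_Suc_atMost)
  have lt: "\<bar>S (x i) \<bullet> S (x j)\<bar> \<le> \<eta>" if "i < j" "j \<le> n" for i j
  proof -
    have "\<forall>l\<le>i. x j \<bullet> x l = 0"
      using orthonormal_onD[OF on, of j] that by auto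
    then have "\<bar>S (x i) \<bullet> S (x j)\<bar> \<le> \<eta> * norm (x j)"
      using x that by (simp add: P_def)
    then show ?thesis using norm_orthonormal[OF on, of j] that by simp
  qed
  show ?thesis
  proof (rule that[OF on])
    show "s < norm (S (x i))" if "i \<le> n" for i using x that by (simp add: P_def)
    show "\<bar>S (x i) \<bullet> S (x j)\<bar> \<le> \<eta>" if "i \<le> n" "j \<le> n" "i \<noteq> j" for i j
      using lt[of i j] lt[of j i] that by (cases "i < j") (auto simp: inner_commute)
  qed
qed

text \<open>The Gram matrix of the images of an almost singular system has diagonal entries above
  \<open>s\<^sup>2\<close> and tiny entries elsewhere, so \<open>norm (S f)\<close> is at least
  \<open>r * norm f\<close> on its span. Hence the unit ball of that span is mapped onto a set
  containing a ball of radius \<open>r\<close>.\<close>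

theorem e_lin_le_bernstein_width:
  fixes S :: "'f::real_inner \<Rightarrow> 'h::real_inner"
  assumes "bounded_linear S" "inj S"
  shows "e_lin S n \<le> bernstein_width S n"
proof (rule dense_le)
  interpret S: bounded_linear S by fact
  fix u assume "u < e_lin S n"
  then obtain m where m: "u < m" "m < e_lin S n" using dense by blast
  obtain s where s: "0 \<le> s" "m = ennreal s" using m(2) by (cases m) auto
  obtain r where r: "0 \<le> r" "u = ennreal r" using m by (cases u) auto
  have "r < s" using m(1) s r by (simp add: ennreal_less_iff)
  \<comment> \<open>\<open>n + 1\<close> is the Cauchy-Schwarz factor between the square of the sum
    of the \<open>\<bar>a i\<bar>\<close> and the sum of their squares, so the mixed terms cost at
    most the gap between \<open>s\<^sup>2\<close> and \<open>r\<^sup>2\<close>.\<close>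
  define \<eta> where "\<eta> = (s\<^sup>2 - r\<^sup>2) / (n + 1)"
  have "0 < \<eta>" using \<open>r < s\<close> r(1) by (simp add: \<eta>_def power_strict_mono)
  then obtain x where x: "orthonormal_on {..n} x" "\<And>i. i \<le> n \<Longrightarrow> s < norm (S (x i))"
    "\<And>i j. i \<le> n \<Longrightarrow> j \<le> n \<Longrightarrow> i \<noteq> j \<Longrightarrow> \<bar>S (x i) \<bullet> S (x j)\<bar> \<le> \<eta>"
    using almost_singular_system[OF assms(1) s(1)] m(2) s(2) by metis
  have low: "r\<^sup>2 * (\<Sum>i\<le>n. (a i)\<^sup>2) \<le> (norm (S (\<Sum>i\<le>n. a i *\<^sub>R x i)))\<^sup>2" for a
  proof -
    have "(\<Sum>i\<le>n. \<bar>a i\<bar>)\<^sup>2 \<le> (n + 1) * (\<Sum>i\<le>n. (a i)\<^sup>2)"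
      using sum_squared_le_sum_of_squares[of "\<lambda>i. \<bar>a i\<bar>" "{..n}"] by (simp add: mult.commute)
    then have "\<eta> * (\<Sum>i\<le>n. \<bar>a i\<bar>)\<^sup>2 \<le> \<eta> * ((n + 1) * (\<Sum>i\<le>n. (a i)\<^sup>2))"
      using \<open>0 < \<eta>\<close> by (intro mult_left_mono) auto
    also have "\<dots> = (s\<^sup>2 - r\<^sup>2) * (\<Sum>i\<le>n. (a i)\<^sup>2)" by (simp add: \<eta>_def)
    finally have "r\<^sup>2 * (\<Sum>i\<le>n. (a i)\<^sup>2) \<le> s\<^sup>2 * (\<Sum>i\<le>n. (a i)\<^sup>2) - \<eta> * (\<Sum>i\<le>n. \<bar>a i\<bar>)\<^sup>2"
      by (simp add: algebra_simps)
    \<comment> \<open>The \<open>\<eta>\<close> term is subtracted on the diagonal too, so that both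
      sides can be compared entry by entry with the Gram form.\<close>
    also have "\<dots> = (\<Sum>i\<le>n. \<Sum>j\<le>n. (if i = j then s\<^sup>2 * (a i)\<^sup>2 else 0) - \<eta> * (\<bar>a i\<bar> * \<bar>a j\<bar>))"
    proof -
      have "(\<Sum>i\<le>n. \<bar>a i\<bar>)\<^sup>2 = (\<Sum>i\<le>n. \<Sum>j\<le>n. \<bar>a i\<bar> * \<bar>a j\<bar>)"
        by (simp add: power2_eq_square sum_product)
      then show ?thesis by (simp add: sum_subtractf sum_distrib_left)
    qed
    also have "\<dots> \<le> (\<Sum>i\<le>n. \<Sum>j\<le>n. a i * (a j * (S (x i) \<bullet> S (x j))))"
    proof (intro sum_mono)
      fix i j assume ij: "i \<in> {..n}" "j \<in> {..n}"
      show "(if i = j then s\<^sup>2 * (a i)\<^sup>2 else 0) - \<eta> * (\<bar>a i\<bar> * \<bar>a j\<bar>)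
          \<le> a i * (a j * (S (x i) \<bullet> S (x j)))"
      proof (cases "i = j")
        case True
        have "s\<^sup>2 \<le> S (x i) \<bullet> S (x i)"
          using x(2)[of i] ij s(1) by (simp add: power_mono less_imp_le flip: power2_norm_eq_inner)
        then have "s\<^sup>2 * (a i)\<^sup>2 \<le> (S (x i) \<bullet> S (x i)) * (a i)\<^sup>2" by (intro mult_right_mono) auto
        moreover have "0 \<le> \<eta> * (\<bar>a i\<bar> * \<bar>a j\<bar>)" using \<open>0 < \<eta>\<close> by simp
        ultimately show ?thesis using True by (simp add: power2_eq_square mult_ac)
      next
        case False
        have "\<bar>a i * (a j * (S (x i) \<bullet> S (x j)))\<bar> \<le> \<bar>a i\<bar> * (\<bar>a j\<bar> * \<eta>)"
          unfolding abs_mult using x(3)[of i j] ij False by (intro mult_left_mono) auto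
        then show ?thesis using False by (simp add: mult_ac)
      qed
    qed
    also have "\<dots> = (norm (S (\<Sum>i\<le>n. a i *\<^sub>R x i)))\<^sup>2"
      unfolding power2_norm_eq_inner S.sum S.scale inner_sum_left
      by (simp add: inner_sum_right sum_distrib_left mult_ac)
    finally show ?thesis .
  qed
  let ?X = "x ` {..n}"
  have "independent (S ` ?X)"
    using linear_independent_injective_image[OF S.linear_axioms orthonormal_imp_independent[OF x(1)]]
      inj_on_subset[OF assms(2)] by blast
  moreover have "card (S ` ?X) = n + 1"
    using card_image[OF inj_on_subset[OF assms(2)], of ?X] card_image[OF orthonormal_imp_inj_on[OF x(1)]]
    by simp
  ultimately have dim: "dim (span (S ` ?X)) = n + 1" using dim_span_eq_card_independent by metis
  have "{y \<in> span (S ` ?X). norm y \<le> r} \<subseteq> S ` {f. norm f \<le> 1}"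
  proof clarify
    fix y assume y: "y \<in> span (S ` ?X)" "norm y \<le> r"
    show "y \<in> S ` {f. norm f \<le> 1}"
    proof (cases "r = 0")
      case True
      then show ?thesis using y(2) by (intro image_eqI[of _ _ 0]) auto
    next
      case False
      obtain f where f: "f \<in> span ?X" "y = S f"
        using y(1) linear_span_image[OF S.linear_axioms, of ?X] by blast
      define a where "a i = f \<bullet> x i" for i
      have fa: "f = (\<Sum>i\<le>n. a i *\<^sub>R x i)"
        using in_span_orthonormal[OF _ x(1) f(1)] by (simp add: a_def)
      have "r\<^sup>2 * (norm f)\<^sup>2 = r\<^sup>2 * (\<Sum>i\<le>n. (a i)\<^sup>2)"
        using norm_sum_orthonormal[OF _ x(1), of a] by (simp add: fa)
      also have "\<dots> \<le> (norm y)\<^sup>2" using low[of a] by (simp add: f(2) fa)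
      also have "\<dots> \<le> r\<^sup>2" using y(2) by (intro power_mono) auto
      finally have "(norm f)\<^sup>2 \<le> 1" using False by simp
      then have "norm f \<le> 1" by (simp add: abs_square_le_1)
      then show ?thesis using f(2) by blast
    qed
  qed
  then show "u \<le> bernstein_width S n"
    unfolding bernstein_width_def r(2) using dim r(1)
    by (intro Sup_upper CollectI exI[of _ r] conjI exI[of _ "span (S ` ?X)"]) auto
qed

section \<open>Manifold widths\<close>

text \<open>Pulls the ball of \<open>Y\<close> back to the unit ball of \<open>'f\<close>:
  injectivity identifies the combination of preimages with the preimage of the combination, whose
  norm is controlled.\<close>

lemma bernstein_ball_coordinates:
  fixes S :: "'f::real_normed_vector \<Rightarrow> 'h::real_inner"
  assumes "linear S" "inj S" "subspace Y" "dim Y = n + 1" "0 < r"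
    and ball: "{y\<in>Y. norm y \<le> r} \<subseteq> S ` {f. norm f \<le> 1}"
  obtains f :: "nat \<Rightarrow> 'f" where "orthonormal_on {..n} (\<lambda>i. S (f i))"
    "\<And>x. (\<Sum>i\<le>n. (x i)\<^sup>2) \<le> 1 \<Longrightarrow> norm (\<Sum>i\<le>n. (r * x i) *\<^sub>R f i) \<le> 1"
proof -
  interpret S: linear S by fact
  obtain e :: "nat \<Rightarrow> 'h" where e: "orthonormal_on {..n} e" "e ` {..n} \<subseteq> Y"
    using orthonormal_in_subspace[OF assms(3), of "Suc n"] assms(4)
    by (auto simp: lessThan_Suc_atMost)
  have img: "\<exists>f. norm f \<le> 1 \<and> S f = r *\<^sub>R y" if "y \<in> Y" "norm y \<le> 1" for y
  proof -
    have "r *\<^sub>R y \<in> {y\<in>Y. norm y \<le> r}"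
      using that \<open>0 < r\<close> assms(3) by (simp add: subspace_scale)
    then show ?thesis using ball by force
  qed
  have "\<exists>f. S f = e i" if "i \<le> n" for i
  proof -
    have "e i \<in> Y" "norm (e i) \<le> 1" using that e norm_orthonormal[OF e(1), of i] by auto
    then obtain f where "S f = r *\<^sub>R e i" using img by blast
    then have "S (inverse r *\<^sub>R f) = e i" using \<open>0 < r\<close> by (simp add: S.scale)
    then show ?thesis by blast
  qed
  then obtain f where f: "\<And>i. i \<le> n \<Longrightarrow> S (f i) = e i" by metis
  show ?thesis
  proof (rule that)
    show "orthonormal_on {..n} (\<lambda>i. S (f i))"
      using e(1) f by (auto simp: orthonormal_on_def)
    fix x :: "nat \<Rightarrow> real" assume x: "(\<Sum>i\<le>n. (x i)\<^sup>2) \<le> 1"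
    let ?y = "\<Sum>i\<le>n. x i *\<^sub>R e i"
    have "?y \<in> Y" using e(2) assms(3) by (intro subspace_sum subspace_scale) auto
    moreover have "norm ?y \<le> 1"
      using norm_sum_orthonormal[OF _ e(1), of x] x abs_square_le_1[of "norm ?y"] by simp
    ultimately obtain g where g: "norm g \<le> 1" "S g = r *\<^sub>R ?y" using img by blast
    have "S (\<Sum>i\<le>n. (r * x i) *\<^sub>R f i) = r *\<^sub>R ?y"
      by (simp add: S.sum S.scale f scaleR_sum_right)
    then have "(\<Sum>i\<le>n. (r * x i) *\<^sub>R f i) = g"
      using g(2) injD[OF \<open>inj S\<close>] by metis
    then show "norm (\<Sum>i\<le>n. (r * x i) *\<^sub>R f i) \<le> 1" using g(1) by simp
  qed
qed

lemma e_cont_le_e_lin: "e_cont S n \<le> e_lin S n"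
proof -
  have "T \<in> manifold_maps n" if "T \<in> linear_maps n" for T :: "'a::real_normed_vector \<Rightarrow> 'b::real_normed_vector"
  proof -
    obtain L h where T: "T = (\<lambda>f. \<Sum>i<n. L i f *\<^sub>R h i)" and L: "\<And>i. i < n \<Longrightarrow> bounded_linear (L i)"
      using \<open>T \<in> linear_maps n\<close> by (auto simp: linear_maps_def)
    let ?N = "\<lambda>f i. if i < n then L i f else 0"
    let ?\<phi> = "\<lambda>x :: nat \<Rightarrow> real. \<Sum>i<n. x i *\<^sub>R h i"
    have "continuous_map euclidean (Euclidean_space n) ?N"
      unfolding continuous_map_componentwise_Euclidean_space
      using L by (auto intro: linear_continuous_on)
    moreover have "continuous_map (Euclidean_space n) euclidean ?\<phi>"
      unfolding continuous_map_Euclidean_space_iff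
      by (intro continuous_intros continuous_on_subset[OF continuous_on_product_coordinates]) auto
    moreover have "T = ?\<phi> \<circ> ?N" by (simp add: T fun_eq_iff)
    ultimately show ?thesis unfolding manifold_maps_def by blast
  qed
  then show ?thesis unfolding e_cont_def e_lin_def by (intro INF_superset_mono) auto
qed

lemma continuous_on_manifold_map_encoder:
  assumes "continuous_map euclidean (Euclidean_space n) N"
  shows "continuous_on UNIV N" "n \<le> i \<Longrightarrow> N f i = 0"
proof -
  have "continuous_map euclidean (powertop_real UNIV) N \<and> N ` UNIV \<subseteq> {x. \<forall>i\<ge>n. x i = 0}"
    using assms by (auto simp: Euclidean_space_def continuous_map_in_subtopology)
  then show "continuous_on UNIV N" "n \<le> i \<Longrightarrow> N f i = 0"
    by (auto simp: euclidean_product_topology)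
qed

theorem bernstein_width_le_e_cont:
  fixes S :: "'f::real_normed_vector \<Rightarrow> 'h::real_inner"
  assumes S: "bounded_linear S" "inj S"
  shows "bernstein_width S n \<le> e_cont S n"
  unfolding bernstein_width_def e_cont_def
proof (intro Sup_least INF_greatest)
  fix \<rho> and T :: "'f \<Rightarrow> 'h"
  assume "\<rho> \<in> {ennreal r | r. r \<ge> 0 \<and>
    (\<exists>Y. subspace Y \<and> dim Y = n + 1 \<and> {y\<in>Y. norm y \<le> r} \<subseteq> S ` {f. norm f \<le> 1})}"
  then obtain r Y where \<rho>: "\<rho> = ennreal r" "0 \<le> r" and Y: "subspace Y" "dim Y = n + 1"
    "{y\<in>Y. norm y \<le> r} \<subseteq> S ` {f. norm f \<le> 1}" by blast
  assume "T \<in> manifold_maps n"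
  then obtain N \<phi> where T: "T = \<phi> \<circ> N" and N: "continuous_map euclidean (Euclidean_space n) N"
    and \<phi>: "continuous_map (Euclidean_space n) euclidean \<phi>"
    unfolding manifold_maps_def by blast
  note N' = continuous_on_manifold_map_encoder[OF N]
  interpret S: bounded_linear S by fact
  show "\<rho> \<le> worst_case_error S T"
  proof (rule ccontr)
    assume "\<not> \<rho> \<le> worst_case_error S T"
    then have lt: "worst_case_error S T < ennreal r" by (simp add: \<rho>)
    then obtain s where s: "0 \<le> s" "worst_case_error S T = ennreal s"
      by (cases "worst_case_error S T") auto
    then have "s < r" using lt by (simp add: ennreal_less_iff)
    have err: "norm (S f - \<phi> (N f)) \<le> s" if "norm f \<le> 1" for f
      using s worst_case_error_le_iff[of s S T] that by (simp add: T)
    have "0 < r" using s(1) \<open>s < r\<close> by simp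
    obtain f where f: "orthonormal_on {..n} (\<lambda>i. S (f i))"
      "\<And>x. (\<Sum>i\<le>n. (x i)\<^sup>2) \<le> 1 \<Longrightarrow> norm (\<Sum>i\<le>n. (r * x i) *\<^sub>R f i) \<le> 1"
      using bernstein_ball_coordinates[OF S.linear_axioms S(2) Y(1,2) \<open>0 < r\<close> Y(3)] by blast
    define D where "D = {x :: nat \<Rightarrow> real. (\<Sum>i\<le>n. (x i)\<^sup>2) \<le> 1 \<and> (\<forall>i>n. x i = 0)}"
    define F where "F x = (\<Sum>i\<le>n. (r * x i) *\<^sub>R f i)" for x :: "nat \<Rightarrow> real"
    have contF: "continuous_on UNIV F"
      unfolding F_def by (intro continuous_intros continuous_on_product_coordinates)
    have contNF: "continuous_on D (\<lambda>x. N (F x))"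
      by (rule continuous_on_compose2[OF N'(1) continuous_on_subset[OF contF]]) auto
    have FD: "norm (F x) \<le> 1" if "x \<in> D" for x
      using f(2) that by (simp add: D_def F_def)
    have SF: "S (F x) \<bullet> S (f i) = r * x i" if "i \<le> n" for x i
      using inner_sum_orthonormal[OF _ f(1), of i "\<lambda>i. r * x i"] that
      by (simp add: F_def S.sum S.scale)
    \<comment> \<open>The encoder enters only through the compact set of its values, so only the
      decoder has to be regularised.\<close>
    define K where "K = (\<lambda>x. N (F x)) ` D"
    have K: "compact K"
      unfolding K_def using compact_continuous_image[OF contNF] compact_coordinate_ball
      by (simp add: D_def)
    have K0: "z i = 0" if "z \<in> K" "n \<le> i" for z i
      using that N'(2) by (auto simp: K_def)
    have bnd: "\<exists>B. \<forall>z\<in>K. \<bar>z i\<bar> \<le> B" for i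
    proof -
      have "compact ((\<lambda>z. z i) ` K)"
        by (intro compact_continuous_image K continuous_on_subset[OF continuous_on_product_coordinates]) auto
      from compact_imp_bounded[OF this] show ?thesis by (auto simp: bounded_iff)
    qed
    obtain B where B: "\<And>z i. z \<in> K \<Longrightarrow> \<bar>z i\<bar> \<le> B i" using bnd by metis
    have Bsum: "\<bar>z i\<bar> \<le> (\<Sum>i<n. \<bar>B i\<bar>)" if "z \<in> K" "i < n" for z i
    proof -
      have "\<bar>z i\<bar> \<le> \<bar>B i\<bar>" using B[OF that(1), of i] by linarith
      also have "\<dots> \<le> (\<Sum>i<n. \<bar>B i\<bar>)" using that(2) by (intro member_le_sum) auto
      finally show ?thesis .
    qed
    \<comment> \<open>Coordinates of the decoded element, rescaled from radius \<open>r\<close> to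
      the unit ball; by Bessel they differ from \<open>x\<close> by at most \<open>s / r\<close> in
      Euclidean norm when \<open>z = N (F x)\<close>.\<close>
    define q where "q j z = \<phi> z \<bullet> S (f j) / r" for j z
    \<comment> \<open>Each of the \<open>n + 1\<close> coordinates moves by at most
      \<open>2 * \<epsilon>\<close>, once for the Lipschitz approximation and once for the shift by
      \<open>w\<close>. The total is half of the gap between \<open>s / r\<close> and 1.\<close>
    define \<epsilon> where "\<epsilon> = (1 - s / r) / (4 * (n + 1))"
    have "0 < \<epsilon>" using \<open>0 < r\<close> \<open>s < r\<close> by (simp add: \<epsilon>_def)
    have contq: "continuous_on K (q j)" for j
    proof -
      have "continuous_on K \<phi>"
        using \<phi> unfolding continuous_map_Euclidean_space_iff topspace_Euclidean_space
        by (rule continuous_on_subset) (use K0 in auto)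
      then show ?thesis unfolding q_def using \<open>0 < r\<close> by (intro continuous_intros) auto
    qed
    define approx where "approx j p L \<longleftrightarrow> continuous_on K p \<and> 0 \<le> L \<and> (\<forall>z\<in>K. \<bar>q j z - p z\<bar> < \<epsilon>) \<and>
      (\<forall>z\<in>K. \<forall>z'\<in>K. \<bar>p z - p z'\<bar> \<le> L * (\<Sum>i<n. \<bar>z i - z' i\<bar>))" for j p L
    have "\<exists>p L. approx j p L" for j
      unfolding approx_def
      by (rule lipschitz_approximation) (use K K0 contq \<open>0 < \<epsilon>\<close> in auto)
    then obtain p L where pL: "\<And>j. approx j (p j) (L j)" by metis
    have p: "continuous_on K (p j)" "0 \<le> L j" "z \<in> K \<Longrightarrow> \<bar>q j z - p j z\<bar> < \<epsilon>"
      "z \<in> K \<Longrightarrow> z' \<in> K \<Longrightarrow> \<bar>p j z - p j z'\<bar> \<le> L j * (\<Sum>i<n. \<bar>z i - z' i\<bar>)" for j z z'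
      using pL[of j] by (auto simp: approx_def)
    have "\<bar>p j z - p j z'\<bar> \<le> (\<Sum>j\<le>n. L j) * (\<Sum>i<n. \<bar>z i - z' i\<bar>)"
      if "j \<le> n" "z \<in> K" "z' \<in> K" for j z z'
    proof -
      have "L j \<le> (\<Sum>j\<le>n. L j)" using that(1) p(2) by (intro member_le_sum) auto
      then have "L j * (\<Sum>i<n. \<bar>z i - z' i\<bar>) \<le> (\<Sum>j\<le>n. L j) * (\<Sum>i<n. \<bar>z i - z' i\<bar>)"
        by (intro mult_right_mono sum_nonneg) auto
      then show ?thesis using p(4)[OF that(2,3), of j] by linarith
    qed
    then have "\<exists>w. (\<forall>j\<le>n. \<bar>w j\<bar> \<le> \<epsilon>) \<and> \<not> (\<exists>z\<in>K. \<forall>j\<le>n. p j z = w j)"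
      by (intro lipschitz_image_misses_cube_point[of K n "\<Sum>i<n. \<bar>B i\<bar>" "\<Sum>j\<le>n. L j"])
        (use Bsum \<open>0 < \<epsilon>\<close> p(2) in \<open>auto intro: sum_nonneg\<close>)
    then obtain w where w: "\<And>j. j \<le> n \<Longrightarrow> \<bar>w j\<bar> \<le> \<epsilon>" "\<not> (\<exists>z\<in>K. \<forall>j\<le>n. p j z = w j)"
      by blast
    \<comment> \<open>Subtracting the missed point \<open>w\<close> moves it to the origin, so the
      zero forced by closeness to the identity says that \<open>w\<close> is hit after all.\<close>
    have "\<exists>x\<in>D. \<forall>i\<le>n. p i (N (F x)) - w i = 0"
      unfolding D_def
    proof (rule near_identity_on_sphere_has_zero, fold D_def)
      show "continuous_on D (\<lambda>x. p i (N (F x)) - w i)" for i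
        by (intro continuous_intros continuous_on_compose2[OF p(1) contNF]) (auto simp: K_def)
      fix x assume x: "x \<in> D"
      let ?z = "N (F x)"
      have z: "?z \<in> K" using x by (simp add: K_def)
      have "L2_set (\<lambda>i. q i ?z - x i) {..n} \<le> s / r"
      proof -
        have "(\<Sum>i\<le>n. (q i ?z - x i)\<^sup>2) = (\<Sum>i\<le>n. ((\<phi> ?z - S (F x)) \<bullet> S (f i))\<^sup>2) / r\<^sup>2"
          unfolding sum_divide_distrib
        proof (rule sum.cong)
          fix i assume "i \<in> {..n}"
          then have "q i ?z - x i = ((\<phi> ?z - S (F x)) \<bullet> S (f i)) / r"
            using \<open>0 < r\<close> by (simp add: q_def inner_diff_left SF diff_divide_distrib)
          then show "(q i ?z - x i)\<^sup>2 = ((\<phi> ?z - S (F x)) \<bullet> S (f i))\<^sup>2 / r\<^sup>2"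
            by (simp add: power_divide)
        qed simp
        also have "\<dots> \<le> (norm (\<phi> ?z - S (F x)))\<^sup>2 / r\<^sup>2"
          by (intro divide_right_mono bessel_inequality f(1)) auto
        also have "\<dots> \<le> s\<^sup>2 / r\<^sup>2"
          using err[OF FD[OF x]] by (intro divide_right_mono power_mono) (auto simp: norm_minus_commute)
        finally have "(\<Sum>i\<le>n. (q i ?z - x i)\<^sup>2) \<le> (s / r)\<^sup>2" by (simp add: power_divide)
        then show ?thesis unfolding L2_set_def
          using s(1) \<open>0 < r\<close> by (intro real_le_lsqrt) (auto intro: sum_nonneg)
      qed
      moreover have "L2_set (\<lambda>i. p i ?z - w i - q i ?z) {..n} \<le> (1 - s / r) / 2"
      proof -
        have "L2_set (\<lambda>i. p i ?z - w i - q i ?z) {..n} \<le> (\<Sum>i\<le>n. \<bar>p i ?z - w i - q i ?z\<bar>)"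
          by (rule L2_set_le_sum_abs)
        also have "\<dots> \<le> (\<Sum>i\<le>n. 2 * \<epsilon>)"
        proof (rule sum_mono)
          fix i assume "i \<in> {..n}"
          then show "\<bar>p i ?z - w i - q i ?z\<bar> \<le> 2 * \<epsilon>"
            using w(1)[of i] p(3)[OF z, of i] by auto
        qed
        also have "\<dots> = (1 - s / r) / 2" by (simp add: \<epsilon>_def field_simps)
        finally show ?thesis .
      qed
      moreover have "L2_set (\<lambda>i. p i ?z - w i - x i) {..n} \<le>
          L2_set (\<lambda>i. q i ?z - x i) {..n} + L2_set (\<lambda>i. p i ?z - w i - q i ?z) {..n}"
        using L2_set_triangle_ineq[of "\<lambda>i. q i ?z - x i" "\<lambda>i. p i ?z - w i - q i ?z" "{..n}"]
        by (simp add: algebra_simps)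
      moreover have "s / r < 1" using \<open>0 < r\<close> \<open>s < r\<close> by simp
      ultimately have "L2_set (\<lambda>i. p i ?z - w i - x i) {..n} < 1" by simp
      then show "(\<Sum>i\<le>n. (p i ?z - w i - x i)\<^sup>2) < 1" by (simp add: L2_set_def)
    qed
    then obtain x where "x \<in> D" "\<And>i. i \<le> n \<Longrightarrow> p i (N (F x)) = w i" by force
    then show False using w(2) by (auto simp: K_def)
  qed
qed

section \<open>Nonlinear widths\<close>

text \<open>The Riesz inequalities sum over the exact support of the coefficients; this passes to
  any finite index set, on which some coefficients may vanish.\<close>

lemma finite_support_sum:
  fixes \<alpha> :: "'k \<Rightarrow> real" and h :: "'k \<Rightarrow> 'h::real_vector"
  assumes "finite K" and \<beta>: "\<And>k. \<beta> k = (if k \<in> K then \<alpha> k else 0)"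
  shows "finite {k. \<beta> k \<noteq> 0}" "(\<Sum>k | \<beta> k \<noteq> 0. \<bar>\<beta> k\<bar>\<^sup>2) = (\<Sum>k\<in>K. (\<alpha> k)\<^sup>2)"
    "(\<Sum>k | \<beta> k \<noteq> 0. \<beta> k *\<^sub>R h k) = (\<Sum>k\<in>K. \<alpha> k *\<^sub>R h k)"
proof -
  have sub: "{k. \<beta> k \<noteq> 0} \<subseteq> K" by (auto simp: \<beta>)
  then show "finite {k. \<beta> k \<noteq> 0}" using assms(1) by (rule finite_subset)
  show "(\<Sum>k | \<beta> k \<noteq> 0. \<bar>\<beta> k\<bar>\<^sup>2) = (\<Sum>k\<in>K. (\<alpha> k)\<^sup>2)"
    by (rule sum.mono_neutral_cong_left) (use sub assms(1) in \<open>auto simp: \<beta>\<close>)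
  show "(\<Sum>k | \<beta> k \<noteq> 0. \<beta> k *\<^sub>R h k) = (\<Sum>k\<in>K. \<alpha> k *\<^sub>R h k)"
    by (rule sum.mono_neutral_cong_left) (use sub assms(1) in \<open>auto simp: \<beta>\<close>)
qed

lemma riesz_lower_finite:
  assumes "riesz_lower h A" "finite K"
  shows "A * sqrt (\<Sum>k\<in>K. (\<alpha> k)\<^sup>2) \<le> norm (\<Sum>k\<in>K. \<alpha> k *\<^sub>R h k)"
proof -
  define \<beta> where "\<beta> k = (if k \<in> K then \<alpha> k else 0)" for k
  note supp = finite_support_sum[of K \<beta> \<alpha>, OF assms(2) \<beta>_def]
  show ?thesis
    using assms(1) supp(1) unfolding riesz_lower_def supp(2,3)[symmetric] by blast
qed

lemma riesz_upper_finite: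
  assumes "riesz_upper h B" "finite K"
  shows "norm (\<Sum>k\<in>K. \<alpha> k *\<^sub>R h k) \<le> B * sqrt (\<Sum>k\<in>K. (\<alpha> k)\<^sup>2)"
proof -
  define \<beta> where "\<beta> k = (if k \<in> K then \<alpha> k else 0)" for k
  note supp = finite_support_sum[of K \<beta> \<alpha>, OF assms(2) \<beta>_def]
  show ?thesis
    using assms(1) supp(1) unfolding riesz_upper_def supp(2,3)[symmetric] by blast
qed

lemma riesz_lower_le_norm: "riesz_lower h A \<Longrightarrow> A \<le> norm (h k)"
  using riesz_lower_finite[of h A "{k}" "\<lambda>_. 1"] by simp

lemma norm_le_riesz_upper: "riesz_upper h B \<Longrightarrow> norm (h k) \<le> B"
  using riesz_upper_finite[of h B "{k}" "\<lambda>_. 1"] by simp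

text \<open>For fixed coefficients the inequality is a closed condition on the constant, so the
  supremum, finite because of \<open>norm (h 0)\<close>, is attained.\<close>

lemma riesz_lower_riesz_A:
  assumes "riesz_basis h"
  shows "riesz_lower h (riesz_A h)"
proof -
  obtain A where A: "riesz_lower h A" using assms by (auto simp: riesz_basis_def)
  have bdd: "bdd_above {A. riesz_lower h A}"
    using riesz_lower_le_norm by (intro bdd_aboveI[of _ "norm (h 0)"]) auto
  have "0 < A" using A by (simp add: riesz_lower_def)
  also have "A \<le> riesz_A h" unfolding riesz_A_def using A bdd by (intro cSup_upper) auto
  finally have "0 < riesz_A h" .
  moreover have "riesz_A h * sqrt (\<Sum>k | \<alpha> k \<noteq> 0. \<bar>\<alpha> k\<bar>\<^sup>2) \<le> norm (\<Sum>k | \<alpha> k \<noteq> 0. \<alpha> k *\<^sub>R h k)"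
    if fin: "finite {k. \<alpha> k \<noteq> 0}" for \<alpha> :: "nat \<Rightarrow> real"
  proof (cases "sqrt (\<Sum>k | \<alpha> k \<noteq> 0. \<bar>\<alpha> k\<bar>\<^sup>2) = 0")
    case False
    let ?s = "sqrt (\<Sum>k | \<alpha> k \<noteq> 0. \<bar>\<alpha> k\<bar>\<^sup>2)"
    have s: "0 < ?s" using False by (smt (verit) real_sqrt_ge_zero sum_nonneg zero_le_power2)
    have "riesz_A h \<le> norm (\<Sum>k | \<alpha> k \<noteq> 0. \<alpha> k *\<^sub>R h k) / ?s"
      unfolding riesz_A_def
    proof (rule cSup_least)
      fix a assume "a \<in> {A. riesz_lower h A}"
      then have "a * ?s \<le> norm (\<Sum>k | \<alpha> k \<noteq> 0. \<alpha> k *\<^sub>R h k)"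
        using fin by (simp add: riesz_lower_def)
      then show "a \<le> norm (\<Sum>k | \<alpha> k \<noteq> 0. \<alpha> k *\<^sub>R h k) / ?s" using s by (simp add: le_divide_eq)
    qed (use A in auto)
    then show ?thesis using s by (simp add: le_divide_eq)
  qed simp
  ultimately show ?thesis by (simp add: riesz_lower_def)
qed

text \<open>The infimum is attained for the same reason; it is positive because it is at least
  \<open>norm (h 0)\<close>, which a lower constant keeps away from 0.\<close>

lemma riesz_upper_riesz_B:
  assumes "riesz_basis h"
  shows "riesz_upper h (riesz_B h)"
proof -
  obtain A B where A: "riesz_lower h A" and B: "riesz_upper h B"
    using assms by (auto simp: riesz_basis_def)
  have "0 < A" using A by (simp add: riesz_lower_def)
  also have "A \<le> norm (h 0)" using A by (rule riesz_lower_le_norm)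
  also have "norm (h 0) \<le> riesz_B h"
    unfolding riesz_B_def using B norm_le_riesz_upper by (intro cInf_greatest) auto
  finally have "0 < riesz_B h" .
  moreover have "norm (\<Sum>k | \<alpha> k \<noteq> 0. \<alpha> k *\<^sub>R h k) \<le> riesz_B h * sqrt (\<Sum>k | \<alpha> k \<noteq> 0. \<bar>\<alpha> k\<bar>\<^sup>2)"
    if fin: "finite {k. \<alpha> k \<noteq> 0}" for \<alpha> :: "nat \<Rightarrow> real"
  proof (cases "sqrt (\<Sum>k | \<alpha> k \<noteq> 0. \<bar>\<alpha> k\<bar>\<^sup>2) = 0")
    case True
    have "norm (\<Sum>k | \<alpha> k \<noteq> 0. \<alpha> k *\<^sub>R h k) \<le> B * sqrt (\<Sum>k | \<alpha> k \<noteq> 0. \<bar>\<alpha> k\<bar>\<^sup>2)"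
      using B fin unfolding riesz_upper_def by blast
    then show ?thesis unfolding True by simp
  next
    case False
    let ?s = "sqrt (\<Sum>k | \<alpha> k \<noteq> 0. \<bar>\<alpha> k\<bar>\<^sup>2)"
    have s: "0 < ?s" using False by (smt (verit) real_sqrt_ge_zero sum_nonneg zero_le_power2)
    have "norm (\<Sum>k | \<alpha> k \<noteq> 0. \<alpha> k *\<^sub>R h k) / ?s \<le> riesz_B h"
      unfolding riesz_B_def
    proof (rule cInf_greatest)
      fix b assume "b \<in> {B. riesz_upper h B}"
      then have "norm (\<Sum>k | \<alpha> k \<noteq> 0. \<alpha> k *\<^sub>R h k) \<le> b * ?s"
        using fin by (simp add: riesz_upper_def)
      then show "norm (\<Sum>k | \<alpha> k \<noteq> 0. \<alpha> k *\<^sub>R h k) / ?s \<le> b" using s by (simp add: divide_le_eq)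
    qed (use B in auto)
    then show ?thesis using s by (simp add: divide_le_eq)
  qed
  ultimately show ?thesis by (simp add: riesz_upper_def)
qed

lemma orthonormal_in_riesz_bases:
  fixes e :: "nat \<Rightarrow> 'h::real_inner"
  assumes e: "orthonormal_on UNIV e" "closure (span (range e)) = UNIV" and "1 \<le> C"
  shows "e \<in> riesz_bases C"
proof -
  have eq: "norm (\<Sum>k | \<alpha> k \<noteq> 0. \<alpha> k *\<^sub>R e k) = sqrt (\<Sum>k | \<alpha> k \<noteq> 0. \<bar>\<alpha> k\<bar>\<^sup>2)"
    if "finite {k. \<alpha> k \<noteq> 0}" for \<alpha> :: "nat \<Rightarrow> real"
    using norm_sum_orthonormal[OF that orthonormal_on_subset[OF e(1)], of \<alpha>]
    by (intro real_sqrt_unique[symmetric]) auto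
  then have low: "riesz_lower e 1" and up: "riesz_upper e 1"
    by (auto simp: riesz_lower_def riesz_upper_def)
  then have basis: "riesz_basis e" using e(2) by (auto simp: riesz_basis_def)
  have "1 \<le> riesz_A e"
    unfolding riesz_A_def using low riesz_lower_le_norm[of e _ 0]
    by (intro cSup_upper bdd_aboveI[of _ "norm (e 0)"]) auto
  moreover have "riesz_B e \<le> 1"
    unfolding riesz_B_def using up
    by (intro cInf_lower bdd_belowI[of _ 0]) (auto simp: riesz_upper_def)
  ultimately have "riesz_B e / riesz_A e \<le> 1" by (simp add: divide_le_eq)
  then show ?thesis using basis \<open>1 \<le> C\<close> by (simp add: riesz_bases_def)
qed

text \<open>The infimum over bases allows one adapted to \<open>T\<close>: if its first
  \<open>n\<close> vectors span the range of \<open>T\<close>, the same \<open>n\<close> indices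
  serve every \<open>f\<close>.\<close>

lemma e_non_le_e_lin:
  fixes S :: "'f::real_normed_vector \<Rightarrow> 'h::real_inner"
  assumes "separable_space (euclidean :: 'h topology)"
    and "\<not> (\<exists>B :: 'h set. finite B \<and> span B = UNIV)" and "1 \<le> C"
  shows "e_non S C n \<le> e_lin S n"
  unfolding e_lin_def
proof (rule INF_greatest)
  fix T :: "'f \<Rightarrow> 'h" assume "T \<in> linear_maps n"
  then obtain L h where T: "T = (\<lambda>f. \<Sum>i<n. L i f *\<^sub>R h i)"
    by (auto simp: linear_maps_def)
  obtain e :: "nat \<Rightarrow> 'h" where e: "orthonormal_on UNIV e" "closure (span (range e)) = UNIV"
    "h ` {..<n} \<subseteq> span (e ` {..<n})"
    using orthonormal_basis_extending[OF assms(1,2)] by blast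
  have "T f = (\<Sum>i<n. (T f \<bullet> e i) *\<^sub>R e i)" for f
  proof -
    have "T f \<in> span (e ` {..<n})"
      unfolding T using e(3) by (intro span_sum span_mul) auto
    from in_span_orthonormal[OF _ orthonormal_on_subset[OF e(1)] this] show ?thesis by simp
  qed
  then have "T \<in> n_term_maps e n"
    unfolding n_term_maps_def
    by (intro CollectI exI[of _ "\<lambda>f i. T f \<bullet> e i"] exI[of _ "\<lambda>f i. i"]) auto
  then show "e_non S C n \<le> worst_case_error S T"
    unfolding e_non_def using orthonormal_in_riesz_bases[OF e(1,2) assms(3)]
    by (meson INF_lower INF_lower2)
qed

lemma span_range_finite_sum:
  assumes "y \<in> span (range h)"
  obtains K \<alpha> where "finite K" "y = (\<Sum>k\<in>K. \<alpha> k *\<^sub>R h k)"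
proof -
  obtain t r where t: "finite t" "t \<subseteq> range h" "y = (\<Sum>a\<in>t. r a *\<^sub>R a)"
    using assms by (auto simp: span_explicit)
  obtain K where K: "inj_on h K" "t = h ` K" using t(2) by (auto simp: subset_image_inj)
  then have "finite K" "y = (\<Sum>k\<in>K. r (h k) *\<^sub>R h k)"
    using t by (simp_all add: finite_image_iff sum.reindex)
  then show ?thesis by (rule that)
qed

text \<open>The orthonormal vectors are replaced by finite combinations of the \<open>h k\<close>, at the price of a
  small perturbation. Among the combinations with coefficients \<open>\<alpha>\<close> bounded by 1, one has at least
  \<open>2 * n + 1\<close> coefficients of absolute value 1, and then any \<open>n\<close> coefficients carry at most half of
  the sum of squares of \<open>\<alpha>\<close>.\<close>

lemma n_term_error_lower_bound:
  fixes h :: "nat \<Rightarrow> 'h::real_inner"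
  assumes low: "riesz_lower h A" and up: "riesz_upper h B" and BA: "B \<le> C * A" and "1 \<le> C"
    and dense: "closure (span (range h)) = UNIV" and e: "orthonormal_on {..2 * n} e"
  shows "\<exists>x. (\<Sum>i\<le>2 * n. (x i)\<^sup>2) = 1 \<and> (\<forall>I c. finite I \<and> card I \<le> n \<longrightarrow>
    1 / (4 * C) \<le> norm ((\<Sum>i\<le>2 * n. x i *\<^sub>R e i) - (\<Sum>k\<in>I. c k *\<^sub>R h k)))"
proof -
  have "0 < A" using low by (simp add: riesz_lower_def)
  \<comment> \<open>Chosen so that \<open>(1 - \<epsilon>) / (2 * C) - \<epsilon>\<close> is still
    at least \<open>1 / (4 * C)\<close>. It is shared among the \<open>2 * n + 1\<close> vectors,
    which gives the total error \<open>\<epsilon> * ?s t\<close>.\<close>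
  define \<epsilon> where "\<epsilon> = 1 / (8 * C)"
  have \<epsilon>: "0 < \<epsilon>" "\<epsilon> \<le> 1 / 8" using \<open>1 \<le> C\<close> by (auto simp: \<epsilon>_def field_simps)
  have "\<exists>K \<alpha>. finite K \<and> norm (e i - (\<Sum>k\<in>K. \<alpha> k *\<^sub>R h k)) \<le> \<epsilon> / (2 * n + 1)" for i
  proof -
    have "e i \<in> closure (span (range h))" using dense by simp
    then obtain y where y: "y \<in> span (range h)" "dist y (e i) < \<epsilon> / (2 * n + 1)"
      using \<epsilon>(1) unfolding closure_approachable by (meson divide_pos_pos of_nat_0_less_iff zero_less_Suc add_gr_0 zero_less_one)
    then show ?thesis
      using span_range_finite_sum[OF y(1)] by (metis dist_norm less_imp_le norm_minus_commute)
  qed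
  then obtain K0 \<alpha>0 where K0: "\<And>i. finite (K0 i)"
    "\<And>i. norm (e i - (\<Sum>k\<in>K0 i. \<alpha>0 i k *\<^sub>R h k)) \<le> \<epsilon> / (2 * n + 1)"
    by metis
  define K where "K = (\<Union>i\<le>2 * n. K0 i)"
  define a where "a i k = (if k \<in> K0 i then \<alpha>0 i k else 0)" for i k
  define \<alpha> where "\<alpha> t k = (\<Sum>i\<le>2 * n. t i * a i k)" for t k
  let ?y = "\<lambda>t. \<Sum>i\<le>2 * n. t i *\<^sub>R e i"
  let ?y' = "\<lambda>t. \<Sum>k\<in>K. \<alpha> t k *\<^sub>R h k"
  let ?s = "\<lambda>t :: nat \<Rightarrow> real. sqrt (\<Sum>i\<le>2 * n. (t i)\<^sup>2)"
  have "finite K" using K0(1) by (simp add: K_def)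
  have norm_y: "norm (?y t) = ?s t" for t
    using norm_sum_orthonormal[OF _ e, of t] by (intro real_sqrt_unique[symmetric]) auto
  have near: "norm (?y t - ?y' t) \<le> \<epsilon> * ?s t" for t
  proof -
    have a: "(\<Sum>k\<in>K. a i k *\<^sub>R h k) = (\<Sum>k\<in>K0 i. \<alpha>0 i k *\<^sub>R h k)" if "i \<le> 2 * n" for i
      by (rule sum.mono_neutral_cong_right)
        (use that \<open>finite K\<close> in \<open>auto simp: a_def K_def\<close>)
    have "?y' t = (\<Sum>i\<le>2 * n. t i *\<^sub>R (\<Sum>k\<in>K. a i k *\<^sub>R h k))"
      unfolding \<alpha>_def scaleR_sum_left scaleR_sum_right
      by (subst sum.swap) simp
    then have "?y t - ?y' t = (\<Sum>i\<le>2 * n. t i *\<^sub>R (e i - (\<Sum>k\<in>K0 i. \<alpha>0 i k *\<^sub>R h k)))"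
      by (simp add: a scaleR_diff_right sum_subtractf)
    also have "norm \<dots> \<le> (\<Sum>i\<le>2 * n. ?s t * (\<epsilon> / (2 * n + 1)))"
    proof (rule sum_norm_le)
      fix i assume "i \<in> {..2 * n}"
      then have "\<bar>t i\<bar> \<le> ?s t"
        by (intro real_le_rsqrt) (auto intro: member_le_sum[where f="\<lambda>i. (t i)\<^sup>2"])
      then show "norm (t i *\<^sub>R (e i - (\<Sum>k\<in>K0 i. \<alpha>0 i k *\<^sub>R h k))) \<le> ?s t * (\<epsilon> / (2 * n + 1))"
        unfolding norm_scaleR using K0(2)[of i] by (intro mult_mono) (auto intro: sum_nonneg)
    qed
    also have "\<dots> = \<epsilon> * ?s t" by simp
    finally show ?thesis .
  qed
  have low_y': "(1 - \<epsilon>) * ?s t \<le> norm (?y' t)" for t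
    using near[of t] norm_triangle_ineq2[of "?y t" "?y' t"] unfolding norm_y
    by (simp add: algebra_simps)
  \<comment> \<open>Combinations close to orthonormal ones cannot vanish, so \<open>t\<close> is
    determined by its coefficients \<open>\<alpha> t\<close>; this is the injectivity that
    \<open>many_unit_coordinates\<close> requires.\<close>
  have zero: "u i = 0" if u: "\<And>k. k \<in> K \<Longrightarrow> \<alpha> u k = 0" and i: "i \<in> {..2 * n}" for u i
  proof -
    have "(1 - \<epsilon>) * ?s u \<le> 0" using low_y'[of u] u by simp
    then have "?s u \<le> 0" using \<epsilon>(2) by (simp add: mult_le_0_iff)
    then have "(\<Sum>i\<le>2 * n. (u i)\<^sup>2) = 0" by (simp add: sum_nonneg order_antisym)
    then show ?thesis using i by (simp add: sum_nonneg_eq_0_iff)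
  qed
  obtain t where t: "\<And>k. k \<in> K \<Longrightarrow> \<bar>\<alpha> t k\<bar> \<le> 1"
    "card {..2 * n} \<le> card {k\<in>K. \<bar>\<alpha> t k\<bar> = 1}"
    using many_unit_coordinates[OF \<open>finite K\<close>, of "{..2 * n}" a] zero unfolding \<alpha>_def by blast
  define \<Sigma> where "\<Sigma> = (\<Sum>k\<in>K. (\<alpha> t k)\<^sup>2)"
  have "2 * n + 1 \<le> \<Sigma>"
  proof -
    have "real (2 * n + 1) \<le> real (card {k\<in>K. \<bar>\<alpha> t k\<bar> = 1})"
      using t(2) by (simp only: card_atMost of_nat_le_iff)
    also have "\<dots> = (\<Sum>k | k \<in> K \<and> \<bar>\<alpha> t k\<bar> = 1. (\<alpha> t k)\<^sup>2)"
    proof -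
      have "(\<alpha> t k)\<^sup>2 = 1" if "\<bar>\<alpha> t k\<bar> = 1" for k
        using that power2_abs[of "\<alpha> t k"] by simp
      then show ?thesis by simp
    qed
    also have "\<dots> \<le> \<Sigma>" unfolding \<Sigma>_def using \<open>finite K\<close> by (intro sum_mono2) auto
    finally show ?thesis by simp
  qed
  have "0 < ?s t"
  proof (rule ccontr)
    assume "\<not> 0 < ?s t"
    then have "?s t = 0" by (smt (verit) real_sqrt_ge_zero sum_nonneg zero_le_power2)
    then have "\<forall>i\<le>2 * n. t i = 0" by (simp add: sum_nonneg_eq_0_iff)
    then have "\<Sigma> = 0" by (simp add: \<Sigma>_def \<alpha>_def)
    then show False using \<open>2 * n + 1 \<le> \<Sigma>\<close> by simp
  qed
  have main: "?s t / (4 * C) \<le> norm (?y t - (\<Sum>k\<in>I. c k *\<^sub>R h k))"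
    if I: "finite I" "card I \<le> n" for I c
  proof -
    define \<beta> where "\<beta> k = (if k \<in> K then \<alpha> t k else 0) - (if k \<in> I then c k else 0)" for k
    have "(\<Sum>k\<in>K \<union> I. \<beta> k *\<^sub>R h k) = ?y' t - (\<Sum>k\<in>I. c k *\<^sub>R h k)"
    proof -
      have "(\<Sum>k\<in>K \<union> I. (if k \<in> K then \<alpha> t k else 0) *\<^sub>R h k) = ?y' t"
        by (rule sum.mono_neutral_cong_right) (use \<open>finite K\<close> I in auto)
      moreover have "(\<Sum>k\<in>K \<union> I. (if k \<in> I then c k else 0) *\<^sub>R h k) = (\<Sum>k\<in>I. c k *\<^sub>R h k)"
        by (rule sum.mono_neutral_cong_right) (use \<open>finite K\<close> I in auto)
      ultimately show ?thesis by (simp add: \<beta>_def scaleR_diff_left sum_subtractf)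
    qed
    then have 1: "A * sqrt (\<Sum>k\<in>K \<union> I. (\<beta> k)\<^sup>2) \<le> norm (?y' t - (\<Sum>k\<in>I. c k *\<^sub>R h k))"
      using riesz_lower_finite[OF low, of "K \<union> I" \<beta>] \<open>finite K\<close> I(1) by simp
    have "(\<Sum>k\<in>K \<inter> I. (\<alpha> t k)\<^sup>2) \<le> (\<Sum>k\<in>K \<inter> I. 1)"
      using t(1) by (intro sum_mono) (auto simp: abs_square_le_1)
    also have "\<dots> \<le> n"
      using card_mono[OF I(1), of "K \<inter> I"] I(2) by simp
    finally have "(\<Sum>k\<in>K \<inter> I. (\<alpha> t k)\<^sup>2) \<le> \<Sigma> / 2" using \<open>2 * n + 1 \<le> \<Sigma>\<close> by simp
    moreover have "\<Sigma> = (\<Sum>k\<in>K \<inter> I. (\<alpha> t k)\<^sup>2) + (\<Sum>k\<in>K - I. (\<alpha> t k)\<^sup>2)"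
      unfolding \<Sigma>_def using \<open>finite K\<close> by (rule sum.Int_Diff)
    \<comment> \<open>Half of \<open>\<Sigma>\<close> survives outside \<open>I\<close>; a quarter
      is kept because its root is simply half of \<open>sqrt \<Sigma>\<close>.\<close>
    ultimately have "\<Sigma> / 4 \<le> (\<Sum>k\<in>K - I. (\<alpha> t k)\<^sup>2)" using \<open>2 * n + 1 \<le> \<Sigma>\<close> by simp
    also have "\<dots> = (\<Sum>k\<in>K - I. (\<beta> k)\<^sup>2)" by (rule sum.cong) (auto simp: \<beta>_def)
    also have "\<dots> \<le> (\<Sum>k\<in>K \<union> I. (\<beta> k)\<^sup>2)" using \<open>finite K\<close> I(1) by (intro sum_mono2) auto
    finally have "sqrt (\<Sigma> / 4) \<le> sqrt (\<Sum>k\<in>K \<union> I. (\<beta> k)\<^sup>2)"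
      by (rule real_sqrt_le_mono)
    then have "A * sqrt (\<Sigma> / 4) \<le> A * sqrt (\<Sum>k\<in>K \<union> I. (\<beta> k)\<^sup>2)"
      using \<open>0 < A\<close> by (intro mult_left_mono) auto
    also note 1
    finally have 2: "A * (sqrt \<Sigma> / 2) \<le> norm (?y' t - (\<Sum>k\<in>I. c k *\<^sub>R h k))"
      by (simp add: real_sqrt_divide)
    \<comment> \<open>The lower constant bounded the error through \<open>sqrt \<Sigma>\<close>; the
      upper constant now bounds \<open>?s t\<close> through the same quantity, which cancels and
      leaves only the ratio \<open>C\<close>.\<close>
    have "(1 - \<epsilon>) * ?s t \<le> norm (?y' t)" by (rule low_y')
    also have "\<dots> \<le> B * sqrt \<Sigma>"
      unfolding \<Sigma>_def using riesz_upper_finite[OF up \<open>finite K\<close>] .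
    also have "\<dots> \<le> C * A * sqrt \<Sigma>"
      using BA \<open>2 * n + 1 \<le> \<Sigma>\<close> by (intro mult_right_mono) auto
    finally have "(1 - \<epsilon>) * ?s t / (2 * C) \<le> A * (sqrt \<Sigma> / 2)"
      using \<open>1 \<le> C\<close> by (simp add: field_simps)
    then have "(1 - \<epsilon>) * ?s t / (2 * C) - \<epsilon> * ?s t \<le> norm (?y t - (\<Sum>k\<in>I. c k *\<^sub>R h k))"
      using 2 near[of t] norm_triangle_ineq[of "?y' t - ?y t" "?y t - (\<Sum>k\<in>I. c k *\<^sub>R h k)"]
      by (simp add: norm_minus_commute)
    moreover have "1 / (4 * C) \<le> (1 - \<epsilon>) / (2 * C) - \<epsilon>"
    proof -
      have "(1 - 1 / 8) / (2 * C) \<le> (1 - \<epsilon>) / (2 * C)"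
        using \<epsilon>(2) \<open>1 \<le> C\<close> by (intro divide_right_mono) auto
      moreover have "1 / (4 * C) \<le> (1 - 1 / 8) / (2 * C) - \<epsilon>"
        using \<open>1 \<le> C\<close> by (simp add: \<epsilon>_def field_simps)
      ultimately show ?thesis by linarith
    qed
    then have "1 / (4 * C) * ?s t \<le> ((1 - \<epsilon>) / (2 * C) - \<epsilon>) * ?s t"
      using \<open>0 < ?s t\<close> by (intro mult_right_mono) auto
    ultimately show ?thesis by (simp add: algebra_simps)
  qed
  define \<nu> where "\<nu> = ?s t"
  have "0 < \<nu>" using \<open>0 < ?s t\<close> by (simp add: \<nu>_def)
  show ?thesis
  proof (intro exI[of _ "\<lambda>i. t i / \<nu>"] conjI allI impI)
    have \<nu>2: "\<nu>\<^sup>2 = (\<Sum>i\<le>2 * n. (t i)\<^sup>2)" by (simp add: \<nu>_def sum_nonneg)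
    have "(\<Sum>i\<le>2 * n. (t i / \<nu>)\<^sup>2) = \<nu>\<^sup>2 / \<nu>\<^sup>2"
      by (simp only: power_divide \<nu>2[symmetric] flip: sum_divide_distrib)
    then show "(\<Sum>i\<le>2 * n. (t i / \<nu>)\<^sup>2) = 1" using \<open>0 < \<nu>\<close> by simp
    fix I :: "nat set" and c assume I: "finite I \<and> card I \<le> n"
    \<comment> \<open>The coefficients \<open>c\<close> are arbitrary, so rescaling them by
      \<open>\<nu>\<close> reduces the normalised claim to \<open>main\<close>.\<close>
    have "(\<Sum>i\<le>2 * n. (t i / \<nu>) *\<^sub>R e i) - (\<Sum>k\<in>I. c k *\<^sub>R h k) =
        inverse \<nu> *\<^sub>R (?y t - (\<Sum>k\<in>I. (\<nu> * c k) *\<^sub>R h k))"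
      using \<open>0 < \<nu>\<close> by (simp add: scaleR_diff_right scaleR_sum_right divide_inverse_commute flip: mult.assoc)
    moreover
    have "\<nu> / (4 * C) \<le> norm (?y t - (\<Sum>k\<in>I. (\<nu> * c k) *\<^sub>R h k))"
      using main[OF conjunct1[OF I] conjunct2[OF I], of "\<lambda>k. \<nu> * c k"] by (simp only: \<nu>_def)
    then have "inverse \<nu> * (\<nu> / (4 * C)) \<le> inverse \<nu> * norm (?y t - (\<Sum>k\<in>I. (\<nu> * c k) *\<^sub>R h k))"
      using \<open>0 < \<nu>\<close> by (intro mult_left_mono) auto
    moreover have "inverse \<nu> * (\<nu> / (4 * C)) = 1 / (4 * C)" using \<open>0 < \<nu>\<close> by simp
    ultimately show "1 / (4 * C) \<le> norm ((\<Sum>i\<le>2 * n. (t i / \<nu>) *\<^sub>R e i) - (\<Sum>k\<in>I. c k *\<^sub>R h k))"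
      using \<open>0 < \<nu>\<close> by simp
  qed
qed

text \<open>The indices of an n-term map may repeat; coefficients at equal indices are added, so
  that at most \<open>n\<close> distinct indices remain.\<close>

lemma n_term_eq_sum_over_set:
  fixes h :: "nat \<Rightarrow> 'h::real_vector"
  obtains I c' where "finite I" "card I \<le> n" "(\<Sum>k<n. c k *\<^sub>R h (i k)) = (\<Sum>k\<in>I. c' k *\<^sub>R h k)"
proof (rule that)
  show "finite (i ` {..<n})" by simp
  show "card (i ` {..<n}) \<le> n" using card_image_le[of "{..<n}" i] by simp
  have "(\<Sum>k<n. c k *\<^sub>R h (i k)) = (\<Sum>m\<in>i ` {..<n}. \<Sum>k | k \<in> {..<n} \<and> i k = m. c k *\<^sub>R h (i k))"
    by (rule sum.image_gen) (rule finite_lessThan)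
  also have "\<dots> = (\<Sum>m\<in>i ` {..<n}. (\<Sum>k | k \<in> {..<n} \<and> i k = m. c k) *\<^sub>R h m)"
    unfolding scaleR_sum_left by (intro sum.cong refl) auto
  finally show "(\<Sum>k<n. c k *\<^sub>R h (i k)) =
    (\<Sum>m\<in>i ` {..<n}. (\<Sum>k | k \<in> {..<n} \<and> i k = m. c k) *\<^sub>R h m)" .
qed

theorem bernstein_width_le_e_non:
  fixes S :: "'f::real_normed_vector \<Rightarrow> 'h::real_inner"
  assumes S: "bounded_linear S" "inj S" and "1 \<le> C"
  shows "bernstein_width S (2 * n) \<le> ennreal (4 * C) * e_non S C n"
  unfolding bernstein_width_def
proof (rule Sup_least)
  interpret S: bounded_linear S by fact
  fix \<rho> assume "\<rho> \<in> {ennreal r | r. r \<ge> 0 \<and>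
    (\<exists>Y. subspace Y \<and> dim Y = 2 * n + 1 \<and> {y\<in>Y. norm y \<le> r} \<subseteq> S ` {f. norm f \<le> 1})}"
  then obtain r Y where \<rho>: "\<rho> = ennreal r" "0 \<le> r" and Y: "subspace Y" "dim Y = 2 * n + 1"
    "{y\<in>Y. norm y \<le> r} \<subseteq> S ` {f. norm f \<le> 1}" by blast
  show "\<rho> \<le> ennreal (4 * C) * e_non S C n"
  proof (cases "r = 0")
    case True
    then show ?thesis by (simp add: \<rho>)
  next
    case False
    then have "0 < r" using \<rho>(2) by simp
    obtain f where f: "orthonormal_on {..2 * n} (\<lambda>i. S (f i))"
      "\<And>x. (\<Sum>i\<le>2 * n. (x i)\<^sup>2) \<le> 1 \<Longrightarrow> norm (\<Sum>i\<le>2 * n. (r * x i) *\<^sub>R f i) \<le> 1"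
      using bernstein_ball_coordinates[OF S.linear_axioms S(2) Y(1,2) \<open>0 < r\<close> Y(3)] by blast
    have "ennreal (r / (4 * C)) \<le> e_non S C n"
      unfolding e_non_def
    proof (intro INF_greatest)
      fix h :: "nat \<Rightarrow> 'h" and T :: "'f \<Rightarrow> 'h"
      assume h: "h \<in> riesz_bases C" and "T \<in> n_term_maps h n"
      then obtain c i where T: "T = (\<lambda>f. \<Sum>k<n. c f k *\<^sub>R h (i f k))"
        by (auto simp: n_term_maps_def)
      have basis: "riesz_basis h" and BA: "riesz_B h / riesz_A h \<le> C"
        using h by (auto simp: riesz_bases_def)
      note low = riesz_lower_riesz_A[OF basis] and up = riesz_upper_riesz_B[OF basis]
      have "riesz_B h \<le> C * riesz_A h"
        using BA low by (simp add: riesz_lower_def divide_le_eq)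
      moreover have "closure (span (range h)) = UNIV" using basis by (simp add: riesz_basis_def)
      ultimately obtain x where x: "(\<Sum>i\<le>2 * n. (x i)\<^sup>2) = 1"
        "\<And>I c. finite I \<Longrightarrow> card I \<le> n \<Longrightarrow>
          1 / (4 * C) \<le> norm ((\<Sum>i\<le>2 * n. x i *\<^sub>R S (f i)) - (\<Sum>k\<in>I. c k *\<^sub>R h k))"
        using n_term_error_lower_bound[OF low up _ \<open>1 \<le> C\<close> _ f(1)] by blast
      \<comment> \<open>\<open>x\<close> depends on the basis alone, so \<open>g\<close> is fixed
        before the indices and coefficients that \<open>T\<close> selects for it, however nonlinear
        that selection is.\<close>
      define g where "g = (\<Sum>i\<le>2 * n. (r * x i) *\<^sub>R f i)"
      have "norm g \<le> 1" using f(2)[of x] x(1) by (simp add: g_def)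
      obtain I c' where I: "finite I" "card I \<le> n" "T g = (\<Sum>k\<in>I. c' k *\<^sub>R h k)"
        using n_term_eq_sum_over_set[where c="c g" and h=h and i="i g" and n=n] unfolding T by blast
      have "S g = r *\<^sub>R (\<Sum>i\<le>2 * n. x i *\<^sub>R S (f i))"
        by (simp add: g_def S.sum S.scale scaleR_sum_right)
      moreover have "T g = r *\<^sub>R (\<Sum>k\<in>I. (c' k / r) *\<^sub>R h k)"
        using \<open>0 < r\<close> by (simp add: I(3) scaleR_sum_right)
      ultimately have "S g - T g =
          r *\<^sub>R ((\<Sum>i\<le>2 * n. x i *\<^sub>R S (f i)) - (\<Sum>k\<in>I. (c' k / r) *\<^sub>R h k))"
        by (simp add: scaleR_diff_right)
      then have "r * (1 / (4 * C)) \<le> norm (S g - T g)"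
        using x(2)[OF I(1,2), of "\<lambda>k. c' k / r"] \<open>0 < r\<close> by (simp del: times_divide_eq_right)
      then have "ennreal (r / (4 * C)) \<le> ennreal (norm (S g - T g))" by (simp add: ennreal_leI)
      also have "\<dots> \<le> worst_case_error S T"
        unfolding worst_case_error_def using \<open>norm g \<le> 1\<close> by (intro SUP_upper) simp
      finally show "ennreal (r / (4 * C)) \<le> worst_case_error S T" .
    qed
    then have "ennreal (4 * C) * ennreal (r / (4 * C)) \<le> ennreal (4 * C) * e_non S C n"
      by (rule mult_left_mono) simp
    moreover have "ennreal (4 * C) * ennreal (r / (4 * C)) = \<rho>"
      using \<open>1 \<le> C\<close> \<rho> by (simp flip: ennreal_mult)
    ultimately show ?thesis by simp
  qed
qed

theorem corollary1:
  fixes A :: "'h::{real_inner,complete_space} \<Rightarrow> 'g::{real_inner,complete_space}"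
    and \<iota> :: "'f::{real_inner,complete_space} \<Rightarrow> 'g"
    and S :: "'f \<Rightarrow> 'h"
  assumes separable: "separable_space (euclidean :: 'h topology)"
    and infinite_dim: "\<not> (\<exists>B :: 'h set. finite B \<and> span B = UNIV)"
    and A: "boundedly_invertible A"
    and embedding: "bounded_linear \<iota>" "inj \<iota>"
    and S: "S = inv A \<circ> \<iota>"
    and bernstein: "(\<lambda>n. bernstein_width S (2 * n)) \<asymp> (\<lambda>n. bernstein_width S n)"
  shows "\<forall>C\<ge>1. (\<forall>n. e_lin S n = e_cont S n) \<and> (\<lambda>n. e_cont S n) \<asymp> (\<lambda>n. e_non S C n)"
proof (intro allI impI)
  fix C :: real assume C: "1 \<le> C"
  have bl: "bounded_linear S"
    using A embedding(1) bounded_linear_compose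
    unfolding S boundedly_invertible_def comp_def by blast
  have "inj (inv A)"
    using A by (simp add: boundedly_invertible_def bij_imp_bij_inv bij_is_inj)
  then have inj: "inj S" unfolding S using embedding(2) by (rule inj_compose)
  \<comment> \<open>The cycle of inequalities from \<open>e_lin\<close> through the Bernstein width
    and \<open>e_cont\<close> back to \<open>e_lin\<close> forces equality.\<close>
  have eq: "e_lin S n = bernstein_width S n" "e_cont S n = bernstein_width S n" for n
    using e_lin_le_bernstein_width[OF bl inj, of n] bernstein_width_le_e_cont[OF bl inj, of n]
      e_cont_le_e_lin[of S n] by auto
  obtain d where d: "0 < d" "\<And>n. bernstein_width S n \<le> ennreal d * bernstein_width S (2 * n)"
    using bernstein unfolding weakly_equivalent_def by blast
  \<comment> \<open>\<open>4 * C\<close> is the price of passing to index \<open>2 * n\<close> in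
    the bound for n-term approximation, and \<open>d\<close> the price of returning to index
    \<open>n\<close>.\<close>
  have "e_cont S n \<le> ennreal (d * (4 * C)) * e_non S C n" for n
  proof -
    have "e_cont S n \<le> ennreal d * bernstein_width S (2 * n)" unfolding eq by (rule d(2))
    also have "\<dots> \<le> ennreal d * (ennreal (4 * C) * e_non S C n)"
      by (intro mult_left_mono bernstein_width_le_e_non[OF bl inj C]) simp
    also have "\<dots> = ennreal (d * (4 * C)) * e_non S C n"
      using d(1) C by (simp add: ennreal_mult mult.assoc)
    finally show ?thesis .
  qed
  moreover have "e_non S C n \<le> ennreal 1 * e_cont S n" for n
    using e_non_le_e_lin[OF separable infinite_dim C, of S n] by (simp add: eq)
  moreover have "0 < d * (4 * C)" using d(1) C by simp
  ultimately have "(\<lambda>n. e_cont S n) \<asymp> (\<lambda>n. e_non S C n)"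
    unfolding weakly_equivalent_def using zero_less_one by blast
  then show "(\<forall>n. e_lin S n = e_cont S n) \<and> (\<lambda>n. e_cont S n) \<asymp> (\<lambda>n. e_non S C n)"
    by (simp add: eq)
qed

end
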